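(* Let $d\ge4$, $g=(d-1)(d-2)/2$, let $\delta\in M_g^{Pl}$, and let $H$ be a non-trivial cyclic subgroup of $Aut(\delta)$. Then the order of $H$ divides one of the integers $d-1$, $d$, $d^2-3d+3$, $(d-1)^2$, $d(d-2)$, $d(d-1)$. Consequently every automorphism of $\delta$ has order $\le d(d-1)$.
   Context: $K$ is an algebraically closed field of characteristic $0$. For $d\ge4$ and $g=(d-1)(d-2)/2$, $M_g^{Pl}$ is the set of isomorphism classes of smooth genus $g$ curves over $K$ admitting a non-singular plane model of degree $d$ in $\mathbb{P}^2(K)$; for such a model $C$, $Aut(\delta)\cong Aut(C)$ is a finite subgroup of $PGL_3(K)$. *)

theory Defs
  imports
    "HOL-Analysis.Analysis"
    "HOL-Algebra.Algebra"
    "HOL-Library.Poly_Mapping"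
begin

section \<open>Ternary forms\<close>

text \<open>
  A polynomial in three variables is a finitely supported map from exponent vectors to
  coefficients; the variables are indexed by the three-element type.
\<close>

type_synonym 'k ternary_poly = "(3 \<Rightarrow>\<^sub>0 nat) \<Rightarrow>\<^sub>0 'k"

definition eval_poly :: "'k::comm_ring_1 ternary_poly \<Rightarrow> 'k ^ 3 \<Rightarrow> 'k" where
  "eval_poly F x =
     (\<Sum>m\<in>Poly_Mapping.keys F. Poly_Mapping.lookup F m * (\<Prod>i\<in>UNIV. x $ i ^ Poly_Mapping.lookup m i))"

text \<open>For exponent \<open>0\<close> the truncated subtraction is harmless: the coefficient then vanishes.\<close>

definition partial_deriv :: "3 \<Rightarrow> 'k::comm_ring_1 ternary_poly \<Rightarrow> 'k ternary_poly" where
  "partial_deriv i F =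
     (\<Sum>m\<in>Poly_Mapping.keys F.
        Poly_Mapping.single (m - Poly_Mapping.single i 1)
          (of_nat (Poly_Mapping.lookup m i) * Poly_Mapping.lookup F m))"

definition homogeneous_of_degree :: "nat \<Rightarrow> 'k::comm_ring_1 ternary_poly \<Rightarrow> bool" where
  "homogeneous_of_degree d F \<longleftrightarrow>
     (\<forall>m\<in>Poly_Mapping.keys F. (\<Sum>i\<in>UNIV. Poly_Mapping.lookup m i) = d)"

section \<open>Plane curves\<close>

text \<open>A point of the projective plane is the set of all its homogeneous coordinate vectors.\<close>

definition proj_point :: "'k::field ^ 3 \<Rightarrow> ('k ^ 3) set" where
  "proj_point x = {c *s x | c. c \<noteq> 0}"

definition zero_locus :: "'k::field ternary_poly \<Rightarrow> ('k ^ 3) set set" where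
  "zero_locus F = {proj_point x | x. x \<noteq> 0 \<and> eval_poly F x = 0}"

definition nonsingular_form :: "'k::field ternary_poly \<Rightarrow> bool" where
  "nonsingular_form F \<longleftrightarrow>
     (\<forall>x. x \<noteq> 0 \<longrightarrow> eval_poly F x = 0 \<longrightarrow> (\<exists>i. eval_poly (partial_deriv i F) x \<noteq> 0))"

text \<open>
  The zero polynomial is homogeneous of every degree, but it is not nonsingular, so the form
  below has degree exactly \<open>d\<close>.
\<close>

definition nonsingular_plane_curve :: "nat \<Rightarrow> ('k::field ^ 3) set set \<Rightarrow> bool" where
  "nonsingular_plane_curve d C \<longleftrightarrow>
     (\<exists>F. homogeneous_of_degree d F \<and> nonsingular_form F \<and> C = zero_locus F)"

section \<open>The projective linear group and automorphisms of plane curves\<close>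

definition GL3 :: "('k::field ^ 3 ^ 3) monoid" where
  "GL3 = \<lparr>carrier = {A. invertible A}, mult = (**), one = mat 1\<rparr>"

definition scalar_matrices :: "('k::field ^ 3 ^ 3) set" where
  "scalar_matrices = {mat c | c. c \<noteq> 0}"

definition PGL3 :: "('k::field ^ 3 ^ 3) set monoid" where
  "PGL3 = GL3 Mod scalar_matrices"

definition proj_act :: "('k::field ^ 3 ^ 3) set \<Rightarrow> ('k ^ 3) set \<Rightarrow> ('k ^ 3) set" where
  "proj_act \<sigma> p = {A *v x | A x. A \<in> \<sigma> \<and> x \<in> p}"

text \<open>
  For a nonsingular plane curve of degree at least \<open>4\<close> every automorphism of the abstract
  curve is induced by a unique projective transformation of the plane, so its automorphism
  group is taken to be the group of projective transformations mapping the curve onto itself.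
\<close>

definition plane_curve_Aut :: "('k::field ^ 3) set set \<Rightarrow> ('k ^ 3 ^ 3) set monoid" where
  "plane_curve_Aut C = PGL3 \<lparr>carrier := {\<sigma> \<in> carrier PGL3. proj_act \<sigma> ` C = C}\<rparr>"

subsection \<open>Well-formedness\<close>

lemma mat_mult_scalar: "mat c ** (A :: 'k::field ^ 3 ^ 3) = A ** mat c"
  by (simp add: matrix_matrix_mult_def mat_def vec_eq_iff mult_delta_left mult_delta_right mult.commute)

lemma mat_mult_mat: "mat c ** mat e = (mat (c * e) :: 'k::field ^ 3 ^ 3)"
  by (simp add: matrix_matrix_mult_def mat_def vec_eq_iff mult_delta_left mult_delta_right)

lemma invertible_mat: "c \<noteq> 0 \<Longrightarrow> invertible (mat c :: 'k::field ^ 3 ^ 3)"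
  unfolding invertible_def by (rule exI[of _ "mat (inverse c)"]) (simp add: mat_mult_mat)

lemma group_GL3: "group (GL3 :: ('k::field ^ 3 ^ 3) monoid)"
proof (rule groupI)
  fix A :: "'k ^ 3 ^ 3" assume "A \<in> carrier GL3"
  then obtain B where B: "A ** B = mat 1" "B ** A = mat 1"
    by (auto simp: GL3_def invertible_def)
  then have "invertible B" by (auto simp: invertible_def)
  with B show "\<exists>B\<in>carrier GL3. B \<otimes>\<^bsub>GL3\<^esub> A = \<one>\<^bsub>GL3\<^esub>"
    by (auto simp: GL3_def)
qed (auto simp: GL3_def invertible_mult invertible_mat matrix_mul_assoc)

lemma normal_scalar_matrices: "scalar_matrices \<lhd> (GL3 :: ('k::field ^ 3 ^ 3) monoid)"
proof -
  interpret group "GL3 :: ('k ^ 3 ^ 3) monoid" by (rule group_GL3)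
  have inv_mat: "inv\<^bsub>GL3\<^esub> (mat c :: 'k ^ 3 ^ 3) = mat (inverse c)" if "c \<noteq> 0" for c :: 'k
    by (rule inv_equality) (use that in \<open>auto simp: GL3_def mat_mult_mat invertible_mat\<close>)
  have "subgroup scalar_matrices (GL3 :: ('k ^ 3 ^ 3) monoid)"
  proof (rule subgroupI)
    show "scalar_matrices \<subseteq> carrier (GL3 :: ('k ^ 3 ^ 3) monoid)"
      by (auto simp: scalar_matrices_def GL3_def invertible_mat)
    show "(scalar_matrices :: ('k ^ 3 ^ 3) set) \<noteq> {}"
      by (auto simp: scalar_matrices_def intro: exI[of _ 1])
    show "inv\<^bsub>GL3\<^esub> A \<in> scalar_matrices" if "A \<in> scalar_matrices" for A :: "'k ^ 3 ^ 3"
    proof -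
      from that obtain c where "c \<noteq> 0" "A = mat c" by (auto simp: scalar_matrices_def)
      then show ?thesis
        using inv_mat[of c] by (auto simp: scalar_matrices_def intro!: exI[of _ "inverse c"])
    qed
    show "A \<otimes>\<^bsub>GL3\<^esub> B \<in> scalar_matrices"
      if "A \<in> scalar_matrices" "B \<in> scalar_matrices" for A B :: "'k ^ 3 ^ 3"
    proof -
      from that obtain c e where "c \<noteq> 0" "A = mat c" "e \<noteq> 0" "B = mat e"
        by (auto simp: scalar_matrices_def)
      then show ?thesis
        by (auto simp: scalar_matrices_def GL3_def mat_mult_mat intro!: exI[of _ "c * e"])
    qed
  qed
  moreover have "scalar_matrices #>\<^bsub>GL3\<^esub> A = A <#\<^bsub>GL3\<^esub> scalar_matrices" for A :: "'k ^ 3 ^ 3"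
    by (auto simp: r_coset_def l_coset_def scalar_matrices_def GL3_def mat_mult_scalar)
  ultimately show ?thesis
    by (intro normalI) auto
qed

lemma group_PGL3: "group (PGL3 :: ('k::field ^ 3 ^ 3) set monoid)"
  unfolding PGL3_def by (rule normal.factorgroup_is_group[OF normal_scalar_matrices])

lemma proj_act_mult:
  "proj_act (\<sigma> \<otimes>\<^bsub>PGL3\<^esub> \<tau>) p = proj_act \<sigma> (proj_act \<tau> p)"
proof -
  have m: "\<sigma> \<otimes>\<^bsub>PGL3\<^esub> \<tau> = {A ** B | A B. A \<in> \<sigma> \<and> B \<in> \<tau>}"
    by (auto simp: PGL3_def FactGroup_def set_mult_def GL3_def)
  have "proj_act (\<sigma> \<otimes>\<^bsub>PGL3\<^esub> \<tau>) p = {(A ** B) *v x | A B x. A \<in> \<sigma> \<and> B \<in> \<tau> \<and> x \<in> p}"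
    unfolding m proj_act_def by blast
  also have "\<dots> = {A *v (B *v x) | A B x. A \<in> \<sigma> \<and> B \<in> \<tau> \<and> x \<in> p}"
    by (simp only: matrix_vector_mul_assoc)
  also have "\<dots> = proj_act \<sigma> (proj_act \<tau> p)"
    unfolding proj_act_def by blast
  finally show ?thesis .
qed

lemma proj_act_one:
  "proj_act \<one>\<^bsub>PGL3\<^esub> (proj_point x) = proj_point x" for x :: "'k::field ^ 3"
proof -
  have mv: "mat c *v y = c *s y" for c :: 'k and y :: "'k ^ 3"
    by (simp add: matrix_vector_mult_def mat_def vec_eq_iff mult_delta_left mult_delta_right)
  have o: "\<one>\<^bsub>PGL3\<^esub> = (scalar_matrices :: ('k ^ 3 ^ 3) set)"
    by (simp add: PGL3_def FactGroup_def)
  have "proj_act \<one>\<^bsub>PGL3\<^esub> (proj_point x) = {mat c *v (e *s x) | c e. c \<noteq> 0 \<and> e \<noteq> 0}"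
    unfolding o proj_act_def scalar_matrices_def proj_point_def by blast
  also have "\<dots> = {(c * e) *s x | c e. c \<noteq> 0 \<and> e \<noteq> 0}"
    by (simp only: mv vector_smult_assoc)
  also have "\<dots> = proj_point x"
  proof (intro equalityI subsetI)
    fix y assume "y \<in> proj_point x"
    then obtain c where "y = (1 * c) *s x" "c \<noteq> 0" by (auto simp: proj_point_def)
    then show "y \<in> {(c * e) *s x | c e. c \<noteq> 0 \<and> e \<noteq> 0}"
      using one_neq_zero by blast
  qed (auto simp: proj_point_def)
  finally show ?thesis .
qed

lemma group_plane_curve_Aut:
  fixes C :: "('k::field ^ 3) set set"
  assumes "nonsingular_plane_curve d C"
  shows "group (plane_curve_Aut C)"
proof -
  interpret P: group "PGL3 :: ('k ^ 3 ^ 3) set monoid" by (rule group_PGL3)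
  have "proj_act \<one>\<^bsub>PGL3\<^esub> p = p" if "p \<in> C" for p
    using assms that by (auto simp: nonsingular_plane_curve_def zero_locus_def proj_act_one)
  then have one: "proj_act \<one>\<^bsub>PGL3\<^esub> ` C = C" by simp
  have comp: "proj_act (\<sigma> \<otimes>\<^bsub>PGL3\<^esub> \<tau>) ` C = proj_act \<sigma> ` (proj_act \<tau> ` C)" for \<sigma> \<tau>
    by (simp add: image_image proj_act_mult)
  have "subgroup {\<sigma> \<in> carrier PGL3. proj_act \<sigma> ` C = C} PGL3"
  proof (rule P.subgroupI)
    show "{\<sigma> \<in> carrier PGL3. proj_act \<sigma> ` C = C} \<noteq> {}"
      using one P.one_closed by blast
    show "inv\<^bsub>PGL3\<^esub> \<sigma> \<in> {\<sigma> \<in> carrier PGL3. proj_act \<sigma> ` C = C}"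
      if "\<sigma> \<in> {\<sigma> \<in> carrier PGL3. proj_act \<sigma> ` C = C}" for \<sigma>
    proof -
      from that have \<sigma>: "\<sigma> \<in> carrier PGL3" "proj_act \<sigma> ` C = C" by auto
      have "proj_act (inv\<^bsub>PGL3\<^esub> \<sigma>) ` C = C"
        using comp[of "inv\<^bsub>PGL3\<^esub> \<sigma>" \<sigma>] unfolding \<sigma>(2) P.l_inv[OF \<sigma>(1)] one by (rule sym)
      then show ?thesis using \<sigma>(1) by simp
    qed
    show "\<sigma> \<otimes>\<^bsub>PGL3\<^esub> \<tau> \<in> {\<sigma> \<in> carrier PGL3. proj_act \<sigma> ` C = C}"
      if "\<sigma> \<in> {\<sigma> \<in> carrier PGL3. proj_act \<sigma> ` C = C}"
        "\<tau> \<in> {\<sigma> \<in> carrier PGL3. proj_act \<sigma> ` C = C}" for \<sigma> \<tau>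
      using that comp[of \<sigma> \<tau>] by simp
  qed auto
  then show ?thesis
    unfolding plane_curve_Aut_def by (rule P.subgroup_imp_group)
qed

end

(*
  A projective automorphism of the curve is the class of a matrix A for which F o A vanishes where F
  does. Restricted to an affine chart whose point at infinity lies off the curve, F is a monic
  squarefree polynomial in K[x][z], so it divides the restriction of F o A; hence F o A = l F.
  If A had a Jordan chain A v = a v, A w = a w + v, comparing the expansions of F and F o A
  at v would show that v is a singular point. So A is diagonalizable, say A v_i = e_i v_i, and by
  nonsingularity at v_i the form contains for every i some monomial x_i^(d-1) x_j, i.e.
  e_i^(d-1) e_j = l. The possible choices of i |-> j yield the listed orders of A modulo scalars.
*)
theory Submission
  imports Defs
begin

text \<open>An automorphism is only known to preserve a set of points, so the first obstacle is to
  recover a form from its zeros: a Nullstellensatz for squarefree polynomials. It rests on Gauss's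
  lemma and on Bezout relations whose right-hand side is a nonzero element of K[x]; over a value of
  x where that side is nonzero, the two polynomials have no common zero. Singularity is tested by
  polarization: F(v + t w) is a polynomial in t whose linear coefficient is the differential at v in
  the direction w. A Jordan chain makes A act on a line by t |-> t + 1, and the resulting difference
  equations force degree at most 1. Up to relabelling, seven maps i |-> j exist. Three fixed points
  give d and two give d(d-1). One fixed point gives d-1, (d-1)^2 or d(d-2), according as the other
  indices are both sent to it, form a chain ending there, or are swapped. A 3-cycle gives d^2-3d+3.
  For the last type, a 2-cycle with a tail, the three monomials do not suffice; since the curve
  contains no line, there is a fourth, and the exponent becomes d-1.\<close>

hide_const (open) Polynomials.degree Polynomials.lead_coeff up_ring.coeff up_ring.monom module.smult

section \<open>Divisibility in \<open>K[x][z]\<close>\<close>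

text \<open>In K[x][z] the outer variable is z. Fixing x leaves a polynomial in z whose roots are
  the zeros lying over x.\<close>

definition eval_fibre :: "'k::comm_ring_1 \<Rightarrow> 'k poly poly \<Rightarrow> 'k poly" where
  "eval_fibre x f = map_poly (\<lambda>p. poly p x) f"

lemma coeff_eval_fibre: "coeff (eval_fibre x f) n = poly (coeff f n) x"
  by (simp add: eval_fibre_def coeff_map_poly)

lemma eval_fibre_mult: "eval_fibre x (f * g) = eval_fibre x f * eval_fibre x g"
  by (rule poly_eqI) (simp add: coeff_eval_fibre coeff_mult poly_sum)

lemma eval_fibre_add: "eval_fibre x (f + g) = eval_fibre x f + eval_fibre x g"
  by (rule poly_eqI) (simp add: coeff_eval_fibre)

lemma eval_fibre_const [simp]: "eval_fibre x [:c:] = [:poly c x:]"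
  by (rule poly_eqI) (simp add: coeff_eval_fibre coeff_pCons split: nat.splits)

lemma eval_fibre_smult: "eval_fibre x (smult c f) = smult (poly c x) (eval_fibre x f)"
  by (rule poly_eqI) (simp add: coeff_eval_fibre)

text \<open>Gauss's lemma, root by root: a linear factor of \<open>c\<close> is prime in K[x][z],
  because specialising at its root lands in the domain K[z]. It therefore divides \<open>a\<close>
  or \<open>b\<close> and can be cancelled.\<close>

lemma gauss_factorization:
  fixes u a b :: "'k::alg_closed_field poly poly"
  assumes "smult c u = a * b" "c \<noteq> 0"
  shows "\<exists>c1 c2 a' b'. c1 \<noteq> 0 \<and> c2 \<noteq> 0 \<and> a = smult c1 a' \<and> b = smult c2 b' \<and> u = a' * b'"
  using assms
proof (induction "degree c" arbitrary: c a b)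
  case 0
  then obtain k where k: "c = [:k:]" "k \<noteq> 0"
    by (metis degree_eq_zeroE pCons_0_0)
  have "u = smult [:inverse k:] a * b"
    using arg_cong[OF 0(2), of "smult [:inverse k:]"] k by (simp add: one_pCons[symmetric] )
  moreover have "a = smult [:k:] (smult [:inverse k:] a)"
    using k by (simp add: one_pCons[symmetric])
  ultimately show ?case
    using k(2) by (metis one_neq_zero pCons_eq_0_iff smult_1_left)
next
  case (Suc n)
  have "degree c > 0" using Suc(2) by simp
  then obtain x where x: "poly c x = 0" using alg_closed_imp_poly_has_root by blast
  then obtain c' where c': "c = [:- x, 1:] * c'" using poly_eq_0_iff_dvd[of c x] by (auto elim: dvdE)
  with Suc.prems have c'0: "c' \<noteq> 0" by auto
  have "degree c = degree [:- x, 1:] + degree c'"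
    unfolding c' by (rule degree_mult_eq) (use c'0 in auto)
  then have deg: "n = degree c'" using Suc(2) by simp
  have div: "\<exists>h'. h = smult [:- x, 1:] h'" if "eval_fibre x h = 0" for h :: "'k poly poly"
  proof -
    have "poly (coeff h i) x = 0" for i using that by (metis coeff_0 coeff_eval_fibre)
    then have "[:[:- x, 1:]:] dvd h" by (simp add: const_poly_dvd_iff poly_eq_0_iff_dvd)
    then show ?thesis by (auto elim!: dvdE)
  qed
  have "eval_fibre x a * eval_fibre x b = 0"
    using arg_cong[OF Suc.prems(1), of "eval_fibre x"] x by (simp add: eval_fibre_mult eval_fibre_smult)
  then consider "eval_fibre x a = 0" | "eval_fibre x b = 0" by auto
  then show ?case
  proof cases
    case 1
    then obtain a1 where a1: "a = smult [:- x, 1:] a1" using div by blast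
    have "smult [:- x, 1:] (smult c' u) = smult [:- x, 1:] (a1 * b)"
      using Suc.prems(1) a1 c' by (simp only: smult_smult mult_smult_left)
    then have "smult c' u = a1 * b" by (rule smult_cancel[rotated]) simp
    from Suc.hyps(1)[OF deg this c'0] obtain c1 c2 a' b'
      where h: "c1 \<noteq> 0" "c2 \<noteq> 0" "a1 = smult c1 a'" "b = smult c2 b'" "u = a' * b'" by blast
    have "[:- x, 1:] * c1 \<noteq> 0" using h(1) by (simp only: mult_eq_0_iff pCons_eq_0_iff) simp
    moreover have "a = smult ([:- x, 1:] * c1) a'" unfolding a1 h(3) by (rule smult_smult)
    ultimately show ?thesis using h by blast
  next
    case 2
    then obtain b1 where b1: "b = smult [:- x, 1:] b1" using div by blast
    have "smult [:- x, 1:] (smult c' u) = smult [:- x, 1:] (a * b1)"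
      using Suc.prems(1) b1 c' by (simp only: smult_smult mult_smult_right)
    then have "smult c' u = a * b1" by (rule smult_cancel[rotated]) simp
    from Suc.hyps(1)[OF deg this c'0] obtain c1 c2 a' b'
      where h: "c1 \<noteq> 0" "c2 \<noteq> 0" "a = smult c1 a'" "b1 = smult c2 b'" "u = a' * b'" by blast
    have "[:- x, 1:] * c2 \<noteq> 0" using h(2) by (simp only: mult_eq_0_iff pCons_eq_0_iff) simp
    moreover have "b = smult ([:- x, 1:] * c2) b'" unfolding b1 h(4) by (rule smult_smult)
    ultimately show ?thesis using h by blast
  qed
qed

lemma unit_lead_coeff_dvd:
  fixes s f :: "'a::idom poly"
  assumes "s dvd f" "lead_coeff f dvd 1"
  shows "lead_coeff s dvd 1"
proof -
  obtain t where "f = s * t" using assms(1) by (rule dvdE)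
  then have "lead_coeff s dvd lead_coeff f" by (simp add: lead_coeff_mult)
  with assms(2) show ?thesis by (rule dvd_trans[rotated])
qed

text \<open>A unit as leading coefficient makes \<open>u\<close> primitive, so the factor
  \<open>c\<close> from K[x] can be cancelled by Gauss's lemma.\<close>

lemma unit_lead_dvd_smultD:
  fixes u h :: "'k::alg_closed_field poly poly"
  assumes "lead_coeff u dvd 1" "u dvd smult c h" "c \<noteq> 0"
  shows "u dvd h"
proof -
  obtain k where "smult c h = u * k" using assms(2) by (auto elim: dvdE)
  from gauss_factorization[OF this assms(3)] obtain c1 u' k'
    where u': "u = smult c1 u'" and h: "h = u' * k'" by blast
  have "c1 dvd 1" using assms(1) u' by (metis dvd_mult_left lead_coeff_smult)
  then obtain e where e: "1 = c1 * e" by (rule dvdE)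
  have "u' = smult e u" unfolding u' by (metis e mult.commute smult_1_left smult_smult)
  then have "h = u * smult e k'" using h by simp
  then show ?thesis by (rule dvdI)
qed

text \<open>A replacement for primality of an irreducible element, in Bezout form.\<close>

lemma dvd_or_bezout:
  fixes u h :: "'k::alg_closed_field poly poly"
  assumes u: "lead_coeff u dvd 1" "degree u > 0"
    and min: "\<And>v. v dvd u \<Longrightarrow> degree v > 0 \<Longrightarrow> degree u \<le> degree v"
  shows "u dvd h \<or> (\<exists>a b c. c \<noteq> 0 \<and> a * u + b * h = [:c:])"
proof -
  \<comment> \<open>\<open>P\<close> describes the nonzero elements of the ideal generated by
    \<open>u\<close> and \<open>h\<close>. One of least degree in z acts as a gcd over the field
    K(x), up to a factor from K[x].\<close>
  define P where "P r \<longleftrightarrow> r \<noteq> 0 \<and> (\<exists>a b. r = a * u + b * h)" for r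
  have "u = 1 * u + 0 * h" by simp
  moreover have "u \<noteq> 0" using u(2) by auto
  ultimately have "P u" unfolding P_def by blast
  then obtain r where r: "P r" and least: "\<And>s. P s \<Longrightarrow> degree r \<le> degree s"
    using ex_has_least_nat[of P u degree] by blast
  from r obtain a b where ab: "r = a * u + b * h" and r0: "r \<noteq> 0" by (auto simp: P_def)
  show ?thesis
  proof (cases "degree r = 0")
    case True
    then obtain c where "r = [:c:]" by (rule degree_eq_zeroE)
    with ab r0 show ?thesis by (metis pCons_0_0)
  next
    case False
    \<comment> \<open>Pseudo-division avoids fractions. The remainder lies in the ideal and has
      smaller degree than \<open>r\<close>, so it is zero.\<close>
    have division: "\<exists>c q. c \<noteq> 0 \<and> smult c x = r * q" if x: "\<exists>a b. x = a * u + b * h" for x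
    proof -
      define m where "m = pseudo_mod x r"
      obtain c q where c: "c \<noteq> 0" "smult c x = r * q + m" and m: "m = 0 \<or> degree m < degree r"
        using pseudo_mod[OF r0, of x] unfolding m_def by blast
      from x obtain a' b' where x': "x = a' * u + b' * h" by blast
      have "m = smult c x - r * q" using c(2) by simp
      also have "\<dots> = ([:c:] * a' - a * q) * u + ([:c:] * b' - b * q) * h"
        unfolding x' ab by (simp add: algebra_simps smult_add_right)
      finally have "m \<noteq> 0 \<Longrightarrow> P m" unfolding P_def by blast
      with m least have "m = 0" by (meson leD)
      with c show ?thesis by auto
    qed
    obtain c q where c: "c \<noteq> 0" "smult c u = r * q"
      using division[of u] \<open>u = 1 * u + 0 * h\<close> by blast
    have "h = 0 * u + 1 * h" by simp
    then obtain c' q' where c': "c' \<noteq> 0" "smult c' h = r * q'"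
      using division[of h] by blast
    from gauss_factorization[OF c(2) c(1)] obtain c1 r1 q1
      where r1: "c1 \<noteq> 0" "r = smult c1 r1" and ur: "u = r1 * q1" by blast
    have "degree r1 > 0" using False r1 by simp
    \<comment> \<open>The hypothesis \<open>min\<close> leaves no room for a proper factor: the
      cofactor \<open>q1\<close> has degree 0 in z and a unit as leading coefficient, so
      \<open>r1\<close> and \<open>u\<close> are associated.\<close>
    then have "degree u \<le> degree r1" using min[of r1] ur by simp
    moreover have "r1 \<noteq> 0" "q1 \<noteq> 0" using ur \<open>u \<noteq> 0\<close> by auto
    ultimately have "degree q1 = 0" using ur by (simp add: degree_mult_eq)
    moreover have "lead_coeff q1 dvd 1" using unit_lead_coeff_dvd[of q1 u] u(1) ur by simp
    ultimately have "q1 dvd 1" by (auto elim!: degree_eq_zeroE simp: is_unit_const_poly_iff)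
    then have "u dvd r1" using ur by (simp add: mult_unit_dvd_iff)
    then have "u dvd smult c' h" unfolding c'(2) r1(2) by (simp add: dvd_smult)
    then show ?thesis using unit_lead_dvd_smultD[OF u(1)] c'(1) by blast
  qed
qed

text \<open>Divisors \<open>s\<close> of \<open>f\<close> are treated by induction on the degree,
  splitting off a factor \<open>u\<close> of least positive degree. A zero of \<open>u\<close> in a
  suitable fibre shows that \<open>u\<close> divides \<open>g\<close>; squarefreeness makes
  \<open>u\<close> coprime, in the Bezout sense, to the remaining cofactor, so that the product
  divides \<open>g\<close> too.\<close>

lemma squarefree_dvd_if_vanishing:
  fixes f g :: "'k::{alg_closed_field, field_char_0} poly poly"
  assumes lead: "lead_coeff f dvd 1"
    and sqf: "\<And>u. degree u > 0 \<Longrightarrow> \<not> u * u dvd f"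
    and van: "\<And>x z. poly (eval_fibre x f) z = 0 \<Longrightarrow> poly (eval_fibre x g) z = 0"
  shows "f dvd g"
proof -
  have "s dvd g" if "s dvd f" for s
    using that
  proof (induction "degree s" arbitrary: s rule: less_induct)
    case less
    have ls: "lead_coeff s dvd 1"
      using unit_lead_coeff_dvd[OF less.prems lead] .
    show ?case
    proof (cases "degree s = 0")
      case True
      then have "s dvd 1" using ls by (auto elim!: degree_eq_zeroE simp: is_unit_const_poly_iff)
      then show ?thesis by (rule unit_imp_dvd)
    next
      case False
      then obtain u where u: "u dvd s" "degree u > 0"
        and min: "\<And>v. v dvd s \<Longrightarrow> degree v > 0 \<Longrightarrow> degree u \<le> degree v"
        using ex_has_least_nat[of "\<lambda>u. u dvd s \<and> degree u > 0" s degree] by auto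
      have lu: "lead_coeff u dvd 1"
        using unit_lead_coeff_dvd[OF u(1) ls] .
      have bezout: "u dvd h \<or> (\<exists>a b c. c \<noteq> 0 \<and> a * u + b * h = [:c:])" for h
        using dvd_or_bezout[OF lu u(2)] min u(1) by (meson dvd_trans)
      have "u dvd g"
      proof (rule ccontr)
        assume "\<not> u dvd g"
        with bezout obtain a b c where c: "c \<noteq> 0" "a * u + b * g = [:c:]" by blast
        \<comment> \<open>Over such an \<open>x\<close> the Bezout relation excludes a common zero
          of \<open>u\<close> and \<open>g\<close>. Yet the fibre of \<open>u\<close> keeps its
          degree, its leading coefficient being a nonzero constant, and hence has a root.\<close>
        obtain x where x: "poly c x \<noteq> 0" using c(1) poly_all_0_iff_0 by blast
        have "coeff (eval_fibre x u) (degree u) \<noteq> 0"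
          using lu by (auto simp: coeff_eval_fibre is_unit_poly_iff)
        then have "degree (eval_fibre x u) > 0" using u(2) le_degree by fastforce
        then obtain z where z: "poly (eval_fibre x u) z = 0"
          using alg_closed_imp_poly_has_root by blast
        have "u dvd f" using u(1) less.prems by (rule dvd_trans)
        then have "poly (eval_fibre x f) z = 0" using z by (auto elim!: dvdE simp: eval_fibre_mult)
        then have "poly (eval_fibre x g) z = 0" by (rule van)
        with z have "poly (eval_fibre x (a * u + b * g)) z = 0"
          by (simp add: eval_fibre_mult eval_fibre_add)
        with c x show False by simp
      qed
      obtain s' where s': "s = u * s'" using u(1) by (rule dvdE)
      have nz: "u \<noteq> 0" "s' \<noteq> 0" using False s' by auto
      then have "degree s' < degree s" using s' u(2) by (simp add: degree_mult_eq)
      moreover have "s' dvd f" using s' less.prems by (metis dvd_mult_right)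
      ultimately have "s' dvd g" by (rule less.hyps)
      then obtain t where t: "g = s' * t" by (rule dvdE)
      have "\<not> u dvd s'"
      proof
        assume "u dvd s'"
        then have "u * u dvd s" unfolding s' by (rule mult_dvd_mono[OF dvd_refl])
        with sqf[OF u(2)] less.prems show False by (meson dvd_trans)
      qed
      with bezout obtain a b c where c: "c \<noteq> 0" "a * u + b * s' = [:c:]" by blast
      have "smult c t = (a * u + b * s') * t" using c by simp
      also have "\<dots> = u * (a * t) + b * g" by (simp add: t algebra_simps)
      finally have "u dvd smult c t" using \<open>u dvd g\<close> by simp
      then have "u dvd t" using unit_lead_dvd_smultD[OF lu] c(1) by blast
      then show ?thesis unfolding s' t by (subst mult.commute) (rule mult_dvd_mono[OF dvd_refl])
    qed
  qed
  then show ?thesis by simp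
qed

section \<open>Restricting forms to lines\<close>

text \<open>The map \<open>e\<close> embeds the coefficients into the ring where the values live.
  One definition thus serves points, lines (values in K[t]) and affine charts (values in
  K[x][z]).\<close>

definition subst_poly :: "('k::comm_ring_1 \<Rightarrow> 'r::comm_ring_1) \<Rightarrow> 'k ternary_poly \<Rightarrow> (3 \<Rightarrow> 'r) \<Rightarrow> 'r" where
  "subst_poly e F L =
     (\<Sum>m\<in>Poly_Mapping.keys F. e (Poly_Mapping.lookup F m) * (\<Prod>i\<in>UNIV. L i ^ Poly_Mapping.lookup m i))"

lemma poly_subst_poly:
  "poly (subst_poly (\<lambda>c. [:e c:]) F L) t = subst_poly e F (\<lambda>i. poly (L i) t)"
  by (simp add: subst_poly_def poly_sum poly_prod)

lemma subst_poly_id: "subst_poly (\<lambda>c. c) F L = eval_poly F (\<chi> i. L i)"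
  by (simp add: subst_poly_def eval_poly_def)

lemma coeff_mult_le_degree:
  assumes "degree p \<le> m" "degree q \<le> n"
  shows "coeff (p * q) (m + n) = coeff p m * coeff q n"
proof -
  have "coeff (p * q) (m + n) = (\<Sum>i\<le>m + n. coeff p i * coeff q (m + n - i))"
    by (rule coeff_mult)
  also have "\<dots> = (\<Sum>i\<in>{m}. coeff p i * coeff q (m + n - i))"
  proof (rule sum.mono_neutral_right)
    show "\<forall>i\<in>{..m + n} - {m}. coeff p i * coeff q (m + n - i) = 0"
    proof
      fix i assume "i \<in> {..m + n} - {m}"
      then consider "i > m" | "m + n - i > n" by fastforce
      then show "coeff p i * coeff q (m + n - i) = 0"
        by cases (use assms in \<open>auto simp: coeff_eq_0\<close>)
    qed
  qed auto
  finally show ?thesis by simp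
qed

lemma degree_linear_power:
  "degree ([:a, b:] ^ n) \<le> n \<and> coeff ([:a, b:] ^ n) n = b ^ n"
  for a b :: "'a::comm_ring_1"
proof (induction n)
  case (Suc n)
  have l: "degree [:a, b:] \<le> 1" by simp
  have "degree ([:a, b:] * [:a, b:] ^ n) \<le> 1 + n"
    using degree_mult_le[of "[:a, b:]" "[:a, b:] ^ n"] l Suc by linarith
  moreover have "coeff ([:a, b:] * [:a, b:] ^ n) (1 + n) = b * b ^ n"
    using coeff_mult_le_degree[of "[:a, b:]" 1 "[:a, b:] ^ n" n] l Suc by simp
  ultimately show ?case by simp
qed simp

lemma degree_prod_linear_powers:
  fixes a b :: "'i \<Rightarrow> 'a::comm_ring_1"
  assumes "finite I"
  shows "degree (\<Prod>i\<in>I. [:a i, b i:] ^ m i) \<le> sum m I \<and>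
         coeff (\<Prod>i\<in>I. [:a i, b i:] ^ m i) (sum m I) = (\<Prod>i\<in>I. b i ^ m i)"
  using assms
proof (induction I)
  case (insert j I)
  let ?p = "[:a j, b j:] ^ m j" and ?q = "\<Prod>i\<in>I. [:a i, b i:] ^ m i"
  have "degree (?p * ?q) \<le> m j + sum m I"
    using degree_mult_le[of ?p ?q] degree_linear_power[of "a j" "b j" "m j"] insert.IH by linarith
  moreover have "coeff (?p * ?q) (m j + sum m I) = b j ^ m j * (\<Prod>i\<in>I. b i ^ m i)"
    using coeff_mult_le_degree[of ?p "m j" ?q "sum m I"] degree_linear_power[of "a j" "b j" "m j"] insert.IH
    by simp
  ultimately show ?case using insert.hyps by simp
qed simp

text \<open>Each monomial turns into a product of \<open>n\<close> linear factors, to whose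
  coefficient in degree \<open>n\<close> only the slopes \<open>b\<close> contribute.\<close>

lemma subst_poly_linear:
  assumes "homogeneous_of_degree n F"
  shows degree_subst_poly_linear: "degree (subst_poly (\<lambda>c. [:e c:]) F (\<lambda>i. [:a i, b i:])) \<le> n"
    and coeff_subst_poly_linear: "coeff (subst_poly (\<lambda>c. [:e c:]) F (\<lambda>i. [:a i, b i:])) n = subst_poly e F b"
proof -
  let ?p = "\<lambda>m. \<Prod>i\<in>UNIV. [:a i, b i:] ^ Poly_Mapping.lookup m i"
  have n: "(\<Sum>i\<in>UNIV. Poly_Mapping.lookup m i) = n" if "m \<in> Poly_Mapping.keys F" for m
    using assms that by (simp add: homogeneous_of_degree_def)
  have d: "degree (?p m) \<le> n" "coeff (?p m) n = (\<Prod>i\<in>UNIV. b i ^ Poly_Mapping.lookup m i)"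
    if "m \<in> Poly_Mapping.keys F" for m
    using degree_prod_linear_powers[of UNIV a b "Poly_Mapping.lookup m"] n[OF that] by auto
  show "degree (subst_poly (\<lambda>c. [:e c:]) F (\<lambda>i. [:a i, b i:])) \<le> n"
    unfolding subst_poly_def
    by (intro degree_sum_le) (auto intro!: order.trans[OF degree_smult_le] d)
  show "coeff (subst_poly (\<lambda>c. [:e c:]) F (\<lambda>i. [:a i, b i:])) n = subst_poly e F b"
    unfolding subst_poly_def by (simp add: coeff_sum d)
qed

definition line_poly :: "'k::comm_ring_1 ternary_poly \<Rightarrow> 'k ^ 3 \<Rightarrow> 'k ^ 3 \<Rightarrow> 'k poly" where
  "line_poly F v w = subst_poly (\<lambda>c. [:c:]) F (\<lambda>i. [:v $ i, w $ i:])"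

lemma poly_line_poly: "poly (line_poly F v w) t = eval_poly F (v + t *s w)"
  unfolding line_poly_def poly_subst_poly subst_poly_id
  by (rule arg_cong[of _ _ "eval_poly F"]) (simp add: vec_eq_iff)

lemma degree_line_poly: "homogeneous_of_degree n F \<Longrightarrow> degree (line_poly F v w) \<le> n"
  unfolding line_poly_def by (rule degree_subst_poly_linear)

lemma coeff_line_poly: "homogeneous_of_degree n F \<Longrightarrow> coeff (line_poly F v w) n = eval_poly F w"
  unfolding line_poly_def by (simp add: coeff_subst_poly_linear subst_poly_id)

section \<open>Evaluation, differentials and Euler's identity\<close>

lemma eval_poly_superset:
  assumes "finite S" "Poly_Mapping.keys F \<subseteq> S"
  shows "eval_poly F x = (\<Sum>m\<in>S. Poly_Mapping.lookup F m * (\<Prod>i\<in>UNIV. x $ i ^ Poly_Mapping.lookup m i))"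
  unfolding eval_poly_def
  by (rule sum.mono_neutral_left) (use assms in \<open>auto simp: in_keys_iff\<close>)

lemma eval_poly_add: "eval_poly (F + G) x = eval_poly F x + eval_poly G x"
proof -
  let ?S = "Poly_Mapping.keys F \<union> Poly_Mapping.keys G"
  have "Poly_Mapping.keys (F + G) \<subseteq> ?S" by (rule Poly_Mapping.keys_add)
  then show ?thesis
    by (simp add: eval_poly_superset[of ?S] lookup_add sum.distrib distrib_right)
qed

lemma eval_poly_0 [simp]: "eval_poly 0 x = 0"
  by (simp add: eval_poly_def)

lemma eval_poly_sum: "eval_poly (\<Sum>a\<in>A. F a) x = (\<Sum>a\<in>A. eval_poly (F a) x)"
  by (induction A rule: infinite_finite_induct) (auto simp: eval_poly_add)

lemma eval_poly_single:
  "eval_poly (Poly_Mapping.single m c) x = c * (\<Prod>i\<in>UNIV. x $ i ^ Poly_Mapping.lookup m i)"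
  by (subst eval_poly_superset[of "{m}"]) auto

text \<open>The differential of \<open>F\<close> at \<open>v\<close> in the direction
  \<open>w\<close>. A zero of \<open>F\<close> is a singular point exactly when this linear function
  of \<open>w\<close> is zero.\<close>

definition polar :: "'k::comm_ring_1 ternary_poly \<Rightarrow> 'k ^ 3 \<Rightarrow> 'k ^ 3 \<Rightarrow> 'k" where
  "polar F v w = (\<Sum>i\<in>UNIV. w $ i * eval_poly (partial_deriv i F) v)"

lemma polar_add: "polar F v (w + w') = polar F v w + polar F v w'"
  by (simp add: polar_def distrib_right sum.distrib)

lemma polar_scale: "polar F v (c *s w) = c * polar F v w"
  by (simp add: polar_def sum_distrib_left mult.assoc)

text \<open>The exponents carry the truncated subtraction of \<open>partial_deriv\<close>. When
  \<open>m i\<close> is 0, the factor \<open>of_nat (m i)\<close> removes the term.\<close>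

lemma poly_pderiv_prod_linear_powers:
  fixes v w :: "'k::idom ^ 3"
  shows "poly (pderiv (\<Prod>i\<in>UNIV. [:v $ i, w $ i:] ^ m i)) 0 =
         (\<Sum>i\<in>UNIV. w $ i * (of_nat (m i) * (\<Prod>j\<in>UNIV. v $ j ^ (m j - (if i = j then 1 else 0)))))"
proof -
  have "poly (pderiv (\<Prod>i\<in>UNIV. [:v $ i, w $ i:] ^ m i)) 0 =
        (\<Sum>i\<in>UNIV. (\<Prod>j\<in>UNIV - {i}. v $ j ^ m j) * (of_nat (m i) * (v $ i ^ (m i - 1) * w $ i)))"
    unfolding pderiv_prod pderiv_power poly_sum poly_mult poly_prod poly_power poly_smult pderiv_pCons
    by (rule sum.cong) simp_all
  also have "\<dots> = (\<Sum>i\<in>UNIV. w $ i * (of_nat (m i) * (\<Prod>j\<in>UNIV. v $ j ^ (m j - (if i = j then 1 else 0)))))"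
  proof (rule sum.cong)
    fix i :: 3
    have "(\<Prod>j\<in>UNIV. v $ j ^ (m j - (if i = j then 1 else 0))) =
       v $ i ^ (m i - 1) * (\<Prod>j\<in>UNIV - {i}. v $ j ^ m j)"
      by (subst prod.remove[of UNIV i]) (auto intro!: prod.cong)
    then show "(\<Prod>j\<in>UNIV - {i}. v $ j ^ m j) * (of_nat (m i) * (v $ i ^ (m i - 1) * w $ i)) =
        w $ i * (of_nat (m i) * (\<Prod>j\<in>UNIV. v $ j ^ (m j - (if i = j then 1 else 0))))"
      by (simp only: mult_ac)
  qed simp
  finally show ?thesis .
qed

text \<open>This is the bridge from univariate identities, such as invariance along a line or a
  double root, to statements about singular points.\<close>

lemma coeff_1_line_poly:
  fixes v w :: "'k::idom ^ 3"
  shows "coeff (line_poly F v w) 1 = polar F v w"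
proof -
  have c1: "coeff p 1 = poly (pderiv p) 0" for p :: "'k poly"
    by (simp add: poly_0_coeff_0 coeff_pderiv)
  have "coeff (line_poly F v w) 1 =
      (\<Sum>m\<in>Poly_Mapping.keys F. Poly_Mapping.lookup F m *
         poly (pderiv (\<Prod>i\<in>UNIV. [:v $ i, w $ i:] ^ Poly_Mapping.lookup m i)) 0)"
    unfolding line_poly_def subst_poly_def coeff_sum c1[symmetric] by simp
  also have "\<dots> = (\<Sum>m\<in>Poly_Mapping.keys F. \<Sum>i\<in>UNIV. w $ i * eval_poly (Poly_Mapping.single
      (m - Poly_Mapping.single i 1) (of_nat (Poly_Mapping.lookup m i) * Poly_Mapping.lookup F m)) v)"
    unfolding poly_pderiv_prod_linear_powers eval_poly_single sum_distrib_left lookup_minus lookup_single when_def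
    by (simp only: mult_ac)
  also have "\<dots> = polar F v w"
    unfolding polar_def partial_deriv_def eval_poly_sum sum_distrib_left by (rule sum.swap)
  finally show ?thesis .
qed

lemma homogeneous_partial_deriv:
  assumes "homogeneous_of_degree d F"
  shows "homogeneous_of_degree (d - 1) (partial_deriv i F)"
  unfolding homogeneous_of_degree_def
proof
  fix k assume "k \<in> Poly_Mapping.keys (partial_deriv i F)"
  moreover define t where
    "t m = Poly_Mapping.single (m - Poly_Mapping.single i 1)
       (of_nat (Poly_Mapping.lookup m i) * Poly_Mapping.lookup F m)" for m
  ultimately have "k \<in> (\<Union>m\<in>Poly_Mapping.keys F. Poly_Mapping.keys (t m))"
    unfolding partial_deriv_def t_def[symmetric] using subsetD[OF keys_sum] by metis
  then obtain m where m: "m \<in> Poly_Mapping.keys F" "k = m - Poly_Mapping.single i 1"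
    "of_nat (Poly_Mapping.lookup m i) * Poly_Mapping.lookup F m \<noteq> 0"
    unfolding t_def by (auto split: if_splits)
  then have pos: "Poly_Mapping.lookup m i > 0" by (metis gr0I mult_zero_left of_nat_0)
  have "(\<Sum>j\<in>UNIV. Poly_Mapping.lookup m j) = d" using assms m(1) by (simp add: homogeneous_of_degree_def)
  then have "Poly_Mapping.lookup m i + (\<Sum>j\<in>UNIV - {i}. Poly_Mapping.lookup m j) = d"
    by (subst (asm) sum.remove[of UNIV i]) auto
  moreover have "(\<Sum>j\<in>UNIV. Poly_Mapping.lookup k j) =
      (Poly_Mapping.lookup m i - 1) + (\<Sum>j\<in>UNIV - {i}. Poly_Mapping.lookup m j)"
    unfolding m(2) by (subst sum.remove[of UNIV i]) (auto simp: lookup_minus lookup_single intro!: sum.cong)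
  ultimately show "(\<Sum>j\<in>UNIV. Poly_Mapping.lookup k j) = d - 1" using pos by simp
qed

lemma eval_poly_scale:
  assumes "homogeneous_of_degree n F"
  shows "eval_poly F (c *s x) = c ^ n * eval_poly F x"
  unfolding eval_poly_def sum_distrib_left
proof (rule sum.cong)
  fix m assume "m \<in> Poly_Mapping.keys F"
  then have "(\<Sum>i\<in>UNIV. Poly_Mapping.lookup m i) = n"
    using assms by (simp add: homogeneous_of_degree_def)
  then show "Poly_Mapping.lookup F m * (\<Prod>i\<in>UNIV. (c *s x) $ i ^ Poly_Mapping.lookup m i) =
      c ^ n * (Poly_Mapping.lookup F m * (\<Prod>i\<in>UNIV. x $ i ^ Poly_Mapping.lookup m i))"
    by (simp add: power_mult_distrib prod.distrib power_sum mult_ac flip: \<open>_ = n\<close>)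
qed simp

lemma eval_poly_zero_vec:
  assumes "homogeneous_of_degree n F" "n > 0"
  shows "eval_poly F 0 = 0"
  using eval_poly_scale[OF assms(1), of 0 0] assms(2) by (simp add: zero_power)

text \<open>Euler's identity, read off from F(v + t v) = (1 + t)^n F(v).\<close>

lemma polar_self:
  fixes v :: "'k::{idom, ring_char_0} ^ 3"
  assumes "homogeneous_of_degree n F"
  shows "polar F v v = of_nat n * eval_poly F v"
proof -
  have "poly (line_poly F v v) t = poly (smult (eval_poly F v) ([:1, 1:] ^ n)) t" for t
  proof -
    have l: "v + t *s v = (1 + t) *s v" by (simp add: vec_eq_iff algebra_simps)
    show ?thesis unfolding poly_line_poly l eval_poly_scale[OF assms] by simp
  qed
  then have "line_poly F v v = smult (eval_poly F v) ([:1, 1:] ^ n)"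
    by (simp add: poly_eq_poly_eq_iff[symmetric] fun_eq_iff)
  moreover have "coeff ([:1, 1 :: 'k:] ^ n) 1 = poly (pderiv ([:1, 1:] ^ n)) 0"
    by (simp add: poly_0_coeff_0 coeff_pderiv)
  ultimately show ?thesis
    by (simp add: coeff_1_line_poly[symmetric] pderiv_power pderiv_pCons)
qed

text \<open>For independent \<open>v\<close> and \<open>w\<close>, coefficient \<open>k\<close>
  belongs to the monomial of degree n - k in the first coordinate and \<open>k\<close> in the
  second. Pulling out \<open>a\<close> by homogeneity leaves the substitution of (b / a) t for
  t.\<close>

lemma coeff_line_poly_scale:
  fixes v w :: "'k::field_char_0 ^ 3"
  assumes "homogeneous_of_degree n F" "a \<noteq> 0" "k \<le> n"
  shows "coeff (line_poly F (a *s v) (b *s w)) k = a ^ (n - k) * b ^ k * coeff (line_poly F v w) k"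
proof -
  have "poly (line_poly F (a *s v) (b *s w)) t = poly (smult (a ^ n) (pcompose (line_poly F v w) [:0, b / a:])) t" for t
  proof -
    have l: "a *s v + t *s (b *s w) = a *s (v + (t * (b / a)) *s w)"
      using assms(2) by (simp add: vec_eq_iff field_simps)
    show ?thesis unfolding poly_line_poly l eval_poly_scale[OF assms(1)] by (simp add: poly_line_poly poly_pcompose)
  qed
  then have "line_poly F (a *s v) (b *s w) = smult (a ^ n) (pcompose (line_poly F v w) [:0, b / a:])"
    by (simp add: poly_eq_poly_eq_iff[symmetric] fun_eq_iff)
  then show ?thesis
    using assms(2,3) by (simp add: coeff_pcompose_linear power_divide power_diff)
qed

lemma matrix_vector_mult_scale: "A *v (c *s x) = c *s (A *v x)"
  for A :: "'a::comm_semiring_1 ^ 'n ^ 'm"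
  by (simp add: matrix_vector_mult_def vec_eq_iff sum_distrib_left mult_ac)

lemma line_poly_invariant:
  fixes A :: "'k::{idom, ring_char_0} ^ 3 ^ 3"
  assumes "\<And>v. eval_poly F (A *v v) = l * eval_poly F v"
  shows "line_poly F (A *v v) (A *v w) = smult l (line_poly F v w)"
proof -
  have "A *v v + t *s (A *v w) = A *v (v + t *s w)" for t
    by (simp add: matrix_vector_right_distrib matrix_vector_mult_scale)
  then have "poly (line_poly F (A *v v) (A *v w)) t = poly (smult l (line_poly F v w)) t" for t
    by (simp add: poly_line_poly assms)
  then show ?thesis by (simp add: poly_eq_poly_eq_iff[symmetric] fun_eq_iff)
qed

text \<open>The differential in a fixed direction \<open>e\<close> along the line v + t w. Its
  coefficient in degree d - 1 is the differential at \<open>w\<close>, so a bound on the degree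
  yields information about \<open>w\<close>.\<close>

definition polar_line_poly :: "'k::comm_ring_1 ternary_poly \<Rightarrow> 'k ^ 3 \<Rightarrow> 'k ^ 3 \<Rightarrow> 'k ^ 3 \<Rightarrow> 'k poly" where
  "polar_line_poly F v w e = (\<Sum>i\<in>UNIV. smult (e $ i) (line_poly (partial_deriv i F) v w))"

lemma poly_polar_line_poly: "poly (polar_line_poly F v w e) t = polar F (v + t *s w) e"
  by (simp add: polar_line_poly_def polar_def poly_sum poly_line_poly)

lemma coeff_polar_line_poly:
  assumes "homogeneous_of_degree d F"
  shows "coeff (polar_line_poly F v w e) (d - 1) = polar F w e"
  unfolding polar_line_poly_def polar_def
  unfolding coeff_sum coeff_smult coeff_line_poly[OF homogeneous_partial_deriv[OF assms]] ..

text \<open>On the curve this is nonsingularity; off the curve Euler's identity shows that the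
  direction \<open>v\<close> itself works.\<close>

lemma nonsingular_imp_polar_nonzero:
  fixes F :: "'k::field_char_0 ternary_poly"
  assumes "homogeneous_of_degree d F" "nonsingular_form F" "d > 0" "v \<noteq> 0"
  shows "\<exists>w. polar F v w \<noteq> 0"
proof (cases "eval_poly F v = 0")
  case True
  then obtain i where "eval_poly (partial_deriv i F) v \<noteq> 0"
    using assms(2,4) by (auto simp: nonsingular_form_def)
  moreover have "polar F v (axis i 1) = eval_poly (partial_deriv i F) v"
    unfolding polar_def axis_def by (simp add: mult_delta_left)
  ultimately show ?thesis by metis
next
  case False
  then show ?thesis using polar_self[OF assms(1), of v] assms(3) by (metis mult_eq_0_iff of_nat_eq_0_iff not_gr0)
qed

section \<open>Matrices preserving the zero locus\<close>

lemma poly_eqI_nonzero: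
  fixes p q :: "'a::{idom, ring_char_0} poly"
  assumes "\<And>t. t \<noteq> 0 \<Longrightarrow> poly p t = poly q t"
  shows "p = q"
proof -
  have "poly ([:0, 1:] * (p - q)) t = 0" for t using assms[of t] by auto
  then have "[:0, 1:] * (p - q) = 0" using poly_all_0_iff_0 by blast
  then have "p - q = 0" by (metis mult_eq_0_iff one_neq_zero pCons_eq_0_iff)
  then show ?thesis by simp
qed

lemma coeff_1_double_root:
  assumes "poly q 0 = (0::'a::idom)"
  shows "coeff (q * q * r) 1 = 0"
proof -
  have "coeff (q * q * r) 1 = poly (pderiv (q * q * r)) 0"
    by (simp add: poly_0_coeff_0 coeff_pderiv)
  then show ?thesis using assms by (simp add: pderiv_mult)
qed

section \<open>Bases of K^3\<close>

lemma span_3_iff: "u \<in> vec.span {a, b, c} \<longleftrightarrow> (\<exists>x y z. u = x *s a + y *s b + z *s c)"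
  for u a b c :: "'k::field ^ 'n"
proof -
  have "u \<in> vec.span {a, b, c} \<longleftrightarrow> (\<exists>x y z. u - x *s a - y *s b - z *s c = 0)"
    by (simp add: vec.span_breakdown_eq)
  also have "\<dots> \<longleftrightarrow> (\<exists>x y z. u = x *s a + y *s b + z *s c)"
    by (simp add: algebra_simps)
  finally show ?thesis .
qed

lemma extend_to_basis:
  fixes S :: "('k::field ^ 3) set"
  assumes "vec.independent S"
  obtains B where "S \<subseteq> B" "vec.independent B" "vec.span B = UNIV" "card B = 3"
proof -
  let ?B = "vec.extend_basis S"
  have i: "S \<subseteq> ?B" "vec.independent ?B" "vec.span ?B = UNIV"
    using vec.extend_basis_superset[OF assms] vec.independent_extend_basis[OF assms]
      vec.span_extend_basis[OF assms] by auto
  moreover have "card ?B = 3"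
    using vec.dim_eq_card[of ?B UNIV] i vec_dim_card[where 'a = 'k and 'n = 3] by simp
  ultimately show thesis by (rule that)
qed

text \<open>With \<open>v\<close> as the point at infinity of a chart, the last condition keeps the
  vectors b + z v of the chart away from zero.\<close>

lemma extend_vector_to_basis:
  fixes v :: "'k::field ^ 3"
  assumes "v \<noteq> 0"
  obtains a b where "vec.independent {a, b, v}" "vec.span {a, b, v} = UNIV" "b \<notin> vec.span {a, v}"
proof -
  have "vec.independent {v}" using assms by (simp add: vec.independent_insert)
  then obtain B where B: "{v} \<subseteq> B" "vec.independent B" "vec.span B = UNIV" "card B = 3"
    by (rule extend_to_basis)
  have "card (B - {v}) = 2" using B by (simp add: card_Diff_singleton)
  then obtain a b where ab: "B - {v} = {a, b}" "a \<noteq> b" by (auto simp: card_2_iff)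
  then have eq: "B = {a, b, v}" using B(1) by auto
  have "b \<notin> {a, v}" using ab by auto
  moreover have "{a, b, v} = insert b {a, v}" by auto
  ultimately have "b \<notin> vec.span {a, v}" using B(2) unfolding eq by (metis vec.independent_insert)
  then show thesis using B eq by (intro that[of a b]) auto
qed

lemma extend_pair_to_basis:
  fixes v w :: "'k::field ^ 3"
  assumes "v \<noteq> 0" "w \<notin> vec.span {v}"
  obtains e where "vec.span {v, w, e} = UNIV"
proof -
  have "vec.independent {v}" using assms(1) by (simp add: vec.independent_insert)
  then have "vec.independent {v, w}" using vec.independent_insertI[OF assms(2)] by (simp add: insert_commute)
  then obtain B where B: "{v, w} \<subseteq> B" "vec.independent B" "vec.span B = UNIV" "card B = 3"
    by (rule extend_to_basis)
  have "v \<noteq> w" using assms(2) by (metis insertI1 vec.span_base)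
  then have "card (B - {v, w}) = 1" using B by (subst card_Diff_subset) auto
  then obtain e where "B - {v, w} = {e}" by (auto simp: card_1_singleton_iff)
  then have "B = {v, w, e}" using B(1) by auto
  then show thesis using B(3) that by blast
qed

lemma polar_eq_0_if_spanning:
  assumes "vec.span {a, b, c} = UNIV" "polar F v a = 0" "polar F v b = 0" "polar F v c = 0"
  shows "polar F v w = (0::'k::field)"
proof -
  have "w \<in> vec.span {a, b, c}" using assms(1) by simp
  then obtain x y z where "w = x *s a + y *s b + z *s c" unfolding span_3_iff by blast
  then show ?thesis using assms by (simp add: polar_add polar_scale)
qed

text \<open>The restriction of \<open>F\<close> to the affine chart \<open>(x, z) \<mapsto> x a + b + z c\<close>, with \<open>z\<close> the outer variable.\<close>

definition chart_poly :: "'k::comm_ring_1 ternary_poly \<Rightarrow> 'k ^ 3 \<Rightarrow> 'k ^ 3 \<Rightarrow> 'k ^ 3 \<Rightarrow> 'k poly poly" where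
  "chart_poly F a b c = subst_poly (\<lambda>k. [:[:k:]:]) F (\<lambda>i. [:[:b $ i, a $ i:], [:c $ i:]:])"

lemma poly_chart_poly:
  "poly (poly (chart_poly F a b c) [:z:]) x = eval_poly F (x *s a + b + z *s c)"
  unfolding chart_poly_def poly_subst_poly subst_poly_id
  by (rule arg_cong[of _ _ "eval_poly F"]) (simp add: vec_eq_iff algebra_simps)

lemma poly_eval_fibre: "poly (eval_fibre x f) z = poly (poly f [:z:]) x"
  by (induction f) (simp_all add: eval_fibre_def map_poly_pCons)

lemma degree_chart_poly: "homogeneous_of_degree d F \<Longrightarrow> degree (chart_poly F a b c) \<le> d"
  unfolding chart_poly_def by (rule degree_subst_poly_linear)

lemma coeff_chart_poly:
  fixes F :: "'k::{idom, ring_char_0} ternary_poly"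
  assumes "homogeneous_of_degree d F"
  shows "coeff (chart_poly F a b c) d = [:eval_poly F c:]"
proof -
  have "poly (subst_poly (\<lambda>k. [:k:]) F (\<lambda>i. [:c $ i:])) t = poly [:eval_poly F c:] t" for t
    unfolding poly_subst_poly subst_poly_id by simp
  then have "subst_poly (\<lambda>k. [:k:]) F (\<lambda>i. [:c $ i:]) = [:eval_poly F c:]"
    by (simp add: poly_eq_poly_eq_iff[symmetric] fun_eq_iff)
  then show ?thesis
    unfolding chart_poly_def by (simp only: coeff_subst_poly_linear[OF assms])
qed

lemma nonsingular_imp_nonzero_value:
  fixes F :: "'k::field_char_0 ternary_poly"
  assumes "homogeneous_of_degree d F" "nonsingular_form F" "d > 0"
  obtains v where "eval_poly F v \<noteq> 0"
proof (rule ccontr)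
  assume "\<not> thesis"
  then have z: "eval_poly F v = 0" for v using that by blast
  have "(axis 1 1 :: 'k ^ 3) \<noteq> 0" by (simp add: axis_eq_0_iff)
  then obtain w where w: "polar F (axis 1 1) w \<noteq> 0"
    using nonsingular_imp_polar_nonzero[OF assms] by blast
  have "line_poly F (axis 1 1) w = 0"
    using poly_all_0_iff_0 by (metis z poly_line_poly)
  with w show False by (metis coeff_0 coeff_1_line_poly)
qed

text \<open>A square factor \<open>u\<close> has a zero over x = 0, and there both partial
  derivatives of the chart polynomial vanish, that is, the differential in the directions
  \<open>a\<close> and \<open>c\<close>. Euler's identity adds the direction of the point itself,
  hence \<open>b\<close>, so the differential is zero: a contradiction.\<close>

lemma chart_poly_squarefree:
  fixes F :: "'k::{alg_closed_field, field_char_0} ternary_poly"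
  assumes F: "homogeneous_of_degree d F" "nonsingular_form F" "d > 0"
    and c: "eval_poly F c \<noteq> 0" and abc: "vec.span {a, b, c} = UNIV" "b \<notin> vec.span {a, c}"
    and u: "degree u > 0"
  shows "\<not> u * u dvd chart_poly F a b c"
proof
  let ?f = "chart_poly F a b c"
  assume "u * u dvd ?f"
  then obtain s where s: "?f = u * u * s" by (rule dvdE)
  have "degree ?f = d"
    using degree_chart_poly[OF F(1)] coeff_chart_poly[OF F(1), of a b c] c
    by (metis le_antisym le_degree pCons_eq_0_iff)
  then have "lead_coeff ?f dvd 1"
    using coeff_chart_poly[OF F(1), of a b c] c by (simp add: is_unit_const_poly_iff dvd_field_iff)
  then have lu: "lead_coeff u dvd 1"
    using s by (metis dvd_triv_left mult.assoc unit_lead_coeff_dvd)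
  have "coeff (eval_fibre 0 u) (degree u) \<noteq> 0"
    using lu by (auto simp: coeff_eval_fibre is_unit_poly_iff)
  then have "degree (eval_fibre 0 u) > 0" using u le_degree by fastforce
  then obtain z where z: "poly (eval_fibre 0 u) z = 0"
    using alg_closed_imp_poly_has_root by blast
  define p where "p = b + z *s c"
  have "p \<noteq> 0"
  proof
    assume "p = 0"
    then have b: "b = - (z *s c)" unfolding p_def by (simp add: eq_neg_iff_add_eq_0)
    have "b \<in> vec.span {a, c}" unfolding b by (intro vec.span_neg vec.span_scale vec.span_base) simp
    with abc(2) show False by simp
  qed
  then obtain w where w: "polar F p w \<noteq> 0" using nonsingular_imp_polar_nonzero[OF F] by blast
  have "poly (line_poly F p a) t = poly (poly ?f [:z:]) t" for t
    unfolding poly_chart_poly poly_line_poly p_def by (simp add: add_ac)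
  then have "line_poly F p a = poly ?f [:z:]"
    by (simp add: poly_eq_poly_eq_iff[symmetric] fun_eq_iff)
  also have "\<dots> = poly u [:z:] * poly u [:z:] * poly s [:z:]" by (simp add: s)
  finally have "polar F p a = 0"
    unfolding coeff_1_line_poly[symmetric] using z
    by (simp only: coeff_1_double_root poly_eval_fibre)
  have root: "poly (pcompose (eval_fibre 0 u) [:z, 1:]) 0 = 0" using z by (simp add: poly_pcompose)
  have "poly (line_poly F p c) t = poly (pcompose (eval_fibre 0 ?f) [:z, 1:]) t" for t
  proof -
    have l: "p + t *s c = 0 *s a + b + (z + t) *s c" by (simp add: p_def vec_eq_iff algebra_simps)
    show ?thesis unfolding poly_line_poly l by (simp add: poly_pcompose poly_eval_fibre poly_chart_poly)
  qed
  then have "line_poly F p c = pcompose (eval_fibre 0 ?f) [:z, 1:]"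
    by (simp add: poly_eq_poly_eq_iff[symmetric] fun_eq_iff)
  also have "\<dots> = pcompose (eval_fibre 0 u) [:z, 1:] * pcompose (eval_fibre 0 u) [:z, 1:]
      * pcompose (eval_fibre 0 s) [:z, 1:]"
    by (simp add: s eval_fibre_mult pcompose_mult)
  finally have "polar F p c = 0"
    unfolding coeff_1_line_poly[symmetric] by (simp only: coeff_1_double_root[OF root])
  have "eval_poly F p = poly (eval_fibre 0 ?f) z"
    by (simp add: poly_eval_fibre poly_chart_poly p_def)
  then have "polar F p p = 0" using z by (simp add: polar_self[OF F(1)] s eval_fibre_mult)
  moreover have "b = p + (- z) *s c" by (simp add: p_def vec_eq_iff)
  ultimately have "polar F p b = 0"
    using \<open>polar F p c = 0\<close> by (metis add_0 mult_zero_right polar_add polar_scale)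
  with polar_eq_0_if_spanning[OF abc(1)] \<open>polar F p a = 0\<close> \<open>polar F p c = 0\<close> w
  show False by blast
qed

text \<open>
  Choosing \<open>c\<close> off the curve makes \<open>chart_poly F a b c\<close> monic in \<open>z\<close> up to a constant, and
  nonsingularity makes it squarefree; so it divides the chart polynomial of \<open>F \<circ> A\<close>.
\<close>

lemma nonsingular_form_preserved_up_to_scalar:
  fixes F :: "'k::{alg_closed_field, field_char_0} ternary_poly" and A :: "'k ^ 3 ^ 3"
  assumes F: "homogeneous_of_degree d F" "nonsingular_form F" "d > 0"
    and A: "\<And>x. eval_poly F x = 0 \<Longrightarrow> eval_poly F (A *v x) = 0"
  obtains l where "\<And>x. eval_poly F (A *v x) = l * eval_poly F x"
proof -
  obtain c where c: "eval_poly F c \<noteq> 0" using nonsingular_imp_nonzero_value[OF F] .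
  then have "c \<noteq> 0" using eval_poly_zero_vec[OF F(1,3)] by auto
  then obtain a b where abc: "vec.span {a, b, c} = UNIV" "b \<notin> vec.span {a, c}"
    using extend_vector_to_basis by metis
  define f where "f = chart_poly F a b c"
  define g where "g = chart_poly F (A *v a) (A *v b) (A *v c)"
  have A_lin: "A *v (x *s a + y *s b + z *s c) = x *s (A *v a) + y *s (A *v b) + z *s (A *v c)" for x y z
    by (simp add: matrix_vector_right_distrib matrix_vector_mult_scale)
  have cf: "coeff f d = [:eval_poly F c:]" and cg: "coeff g d = [:eval_poly F (A *v c):]"
    unfolding f_def g_def by (rule coeff_chart_poly[OF F(1)])+
  have deg_f: "degree f = d"
    using degree_chart_poly[OF F(1), of a b c] cf c unfolding f_def
    by (metis le_antisym le_degree pCons_eq_0_iff)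
  have deg_g: "degree g \<le> d" unfolding g_def by (rule degree_chart_poly[OF F(1)])
  have "f dvd g"
  proof (rule squarefree_dvd_if_vanishing)
    show "lead_coeff f dvd 1" unfolding deg_f cf using c by (simp add: is_unit_const_poly_iff dvd_field_iff)
    show "\<not> u * u dvd f" if "degree u > 0" for u
      unfolding f_def by (rule chart_poly_squarefree[OF F c abc that])
    show "poly (eval_fibre x g) z = 0" if "poly (eval_fibre x f) z = 0" for x z
      using that A[of "x *s a + b + z *s c"] A_lin[of x 1 z]
      by (simp add: poly_eval_fibre f_def g_def poly_chart_poly)
  qed
  then obtain q where q: "g = f * q" by (rule dvdE)
  have "f \<noteq> 0" using cf c by auto
  \<comment> \<open>Comparing degrees in z puts the quotient into K[x]. The coefficients of z^d,
    constant in both charts, then put it into K.\<close>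
  have "degree q = 0"
  proof (cases "q = 0")
    case False
    then have "degree g = d + degree q" using \<open>f \<noteq> 0\<close> by (simp add: q degree_mult_eq deg_f)
    with deg_g show ?thesis by simp
  qed simp
  then obtain q0 where q0: "q = [:q0:]" by (rule degree_eq_zeroE)
  have "[:eval_poly F (A *v c):] = smult (eval_poly F c) q0" using cg cf unfolding q q0 by simp
  then have "degree (smult (eval_poly F c) q0) = 0" by (metis degree_pCons_0)
  then have "degree q0 = 0" using c by simp
  then obtain l where l: "q0 = [:l:]" by (rule degree_eq_zeroE)
  have aff: "eval_poly F (A *v (x *s a + b + z *s c)) = l * eval_poly F (x *s a + b + z *s c)" for x z
  proof -
    have "eval_poly F (A *v (x *s a + b + z *s c)) = poly (poly g [:z:]) x"
      using A_lin[of x 1 z] by (simp add: g_def poly_chart_poly)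
    also have "\<dots> = l * poly (poly f [:z:]) x" by (simp add: q q0 l)
    finally show ?thesis by (simp add: f_def poly_chart_poly)
  qed
  \<comment> \<open>Homogeneity extends the identity from y = 1 to every nonzero
    \<open>y\<close>.\<close>
  have nz: "eval_poly F (A *v (x *s a + y *s b + z *s c)) = l * eval_poly F (x *s a + y *s b + z *s c)"
    if "y \<noteq> 0" for x y z
  proof -
    have e: "x *s a + y *s b + z *s c = y *s ((x / y) *s a + b + (z / y) *s c)"
      using that by (simp add: vec_eq_iff field_simps)
    show ?thesis unfolding e matrix_vector_mult_scale eval_poly_scale[OF F(1)] aff by simp
  qed
  show thesis
  proof (rule that)
    fix u
    have "u \<in> vec.span {a, b, c}" using abc(1) by simp
    then obtain x y z where u: "u = x *s a + y *s b + z *s c" unfolding span_3_iff by blast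
    define w where "w = x *s a + z *s c"
    \<comment> \<open>Both sides are polynomials in the coordinate of \<open>b\<close>; agreeing at
      all nonzero values, they also agree at 0, the line at infinity of the chart.\<close>
    have "line_poly F (A *v w) (A *v b) = smult l (line_poly F w b)"
    proof (rule poly_eqI_nonzero)
      fix t :: 'k assume "t \<noteq> 0"
      have e: "x *s a + t *s b + z *s c = w + t *s b" by (simp add: w_def add_ac)
      have "A *v (w + t *s b) = A *v w + t *s (A *v b)"
        by (simp add: matrix_vector_right_distrib matrix_vector_mult_scale)
      then show "poly (line_poly F (A *v w) (A *v b)) t = poly (smult l (line_poly F w b)) t"
        using nz[OF \<open>t \<noteq> 0\<close>, of x z] unfolding e by (simp add: poly_line_poly)
    qed
    then have "poly (line_poly F (A *v w) (A *v b)) y = l * poly (line_poly F w b) y" by simp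
    moreover have "u = w + y *s b" by (simp add: u w_def add_ac)
    moreover have "A *v u = A *v w + y *s (A *v b)"
      unfolding \<open>u = w + y *s b\<close> by (simp add: matrix_vector_right_distrib matrix_vector_mult_scale)
    ultimately show "eval_poly F (A *v u) = l * eval_poly F u" by (simp add: poly_line_poly)
  qed
qed

section \<open>Jordan chains\<close>

lemma coeff_pcompose_shift:
  fixes p :: "'a::idom poly"
  assumes "degree p = Suc m"
  shows "coeff (pcompose p [:1, 1:]) (Suc m) = coeff p (Suc m)"
    and "coeff (pcompose p [:1, 1:]) m = coeff p m + of_nat (Suc m) * coeff p (Suc m)"
proof -
  have "pcompose p [:1, 1:] = (\<Sum>k\<le>degree p. [:coeff p k:] * [:1, 1:] ^ k)"
    by (simp add: pcompose_altdef poly_altdef degree_map_poly coeff_map_poly)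
  moreover have "coeff ([:1, 1:] ^ k) j = (of_nat (k choose j) :: 'a)" for k j
  proof (cases "j \<le> k")
    case False
    moreover have "degree ([:1, 1 :: 'a:] ^ k) \<le> k" using degree_linear_power by blast
    ultimately show ?thesis by (simp add: coeff_eq_0 binomial_eq_0)
  qed (simp add: coeff_linear_poly_power)
  ultimately have c: "coeff (pcompose p [:1, 1:]) j = (\<Sum>k\<le>Suc m. coeff p k * of_nat (k choose j))" for j
    by (simp add: coeff_sum flip: assms)
  have "(\<Sum>k\<le>m. coeff p k * of_nat (k choose Suc m)) = 0"
    by (rule sum.neutral) (simp add: binomial_eq_0)
  then show "coeff (pcompose p [:1, 1:]) (Suc m) = coeff p (Suc m)"
    unfolding c by simp
  have "(\<Sum>k<m. coeff p k * of_nat (k choose m)) = 0"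
    by (rule sum.neutral) (simp add: binomial_eq_0)
  then show "coeff (pcompose p [:1, 1:]) m = coeff p m + of_nat (Suc m) * coeff p (Suc m)"
    unfolding c by (simp add: lessThan_Suc_atMost[symmetric] algebra_simps)
qed

text \<open>In degree m + 1 the leading coefficients force \<open>r\<close> = \<open>l\<close>; the
  next ones then require l (m + 1) times the leading coefficient to be 0, impossible in
  characteristic 0. The constant \<open>c\<close> can interfere only for m = 0.\<close>

lemma degree_shift_equation:
  fixes p :: "'a::{idom, ring_char_0} poly"
  assumes eq: "[:c:] + smult r (pcompose p [:1, 1:]) = smult l p" and l: "l \<noteq> 0"
  shows "degree p \<le> 1" and "c = 0 \<Longrightarrow> degree p = 0"
proof -
  have False if n: "degree p = Suc m" and m: "c = 0 \<or> m > 0" for m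
  proof -
    have lc: "coeff p (Suc m) \<noteq> 0" using n by (metis degree_0 leading_coeff_0_iff nat.distinct(1))
    have "coeff ([:c:] + smult r (pcompose p [:1, 1:])) (Suc m) = l * coeff p (Suc m)"
      using eq by simp
    then have "r = l" using lc by (simp add: coeff_pcompose_shift[OF n])
    have "coeff ([:c:] + smult r (pcompose p [:1, 1:])) m = l * coeff p m"
      using eq by simp
    then have "r * (coeff p m + of_nat (Suc m) * coeff p (Suc m)) = l * coeff p m"
      using m by (auto simp: coeff_pcompose_shift[OF n] coeff_pCons split: nat.splits)
    then have "l * (of_nat (Suc m) * coeff p (Suc m)) = 0"
      unfolding \<open>r = l\<close> by (simp add: distrib_left)
    with l lc show False by (simp only: mult_eq_0_iff of_nat_eq_0_iff) simp
  qed
  note shift_False = this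
  show "degree p \<le> 1"
  proof (rule ccontr)
    assume "\<not> degree p \<le> 1"
    then have "degree p = Suc (degree p - 1)" "degree p - 1 > 0" by auto
    with shift_False show False by blast
  qed
  show "degree p = 0" if "c = 0"
    by (cases "degree p") (use shift_False that in auto)
qed

lemma polar_invariant:
  fixes A :: "'k::{idom, ring_char_0} ^ 3 ^ 3"
  assumes "\<And>v. eval_poly F (A *v v) = l * eval_poly F v"
  shows "polar F (A *v v) (A *v w) = l * polar F v w"
  using line_poly_invariant[of F A l v w] assms by (simp add: coeff_1_line_poly[symmetric])

lemma polar_eq_0_if_constant:
  fixes F :: "'k::{idom, ring_char_0} ternary_poly"
  assumes "\<And>t. eval_poly F (v + t *s w) = c"
  shows "polar F v w = 0"
proof -
  have "poly (line_poly F v w) t = poly [:c:] t" for t by (simp add: poly_line_poly assms)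
  then have "line_poly F v w = [:c:]" by (simp add: poly_eq_poly_eq_iff[symmetric] fun_eq_iff)
  then show ?thesis by (simp add: coeff_1_line_poly[symmetric])
qed

text \<open>By homogeneity F(v + t w) = t^d F(w + v / t), which exchanges the two ends of the
  line.\<close>

lemma line_poly_swap:
  fixes F :: "'k::field_char_0 ternary_poly"
  assumes F: "homogeneous_of_degree d F" and c: "\<And>t. eval_poly F (w + t *s v) = c"
  shows "line_poly F v w = monom c d"
proof (rule poly_eqI_nonzero)
  fix t :: 'k assume "t \<noteq> 0"
  then have e: "v + t *s w = t *s (w + (1 / t) *s v)" by (simp add: vec_eq_iff field_simps)
  show "poly (line_poly F v w) t = poly (monom c d) t"
    unfolding poly_line_poly e eval_poly_scale[OF F] c by (simp add: poly_monom)
qed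

text \<open>\<open>A\<close> moves w + t v to w + (t + 1) v. Hence \<open>F\<close> is constant on
  this line, which makes the differential at \<open>v\<close> vanish in the directions
  \<open>v\<close> and \<open>w\<close>. In a third direction \<open>e\<close> the differential
  along the line satisfies a shift equation, and its coefficient in degree d - 1, the differential
  at \<open>v\<close>, vanishes as well.\<close>

lemma no_unipotent_chain:
  fixes F :: "'k::field_char_0 ternary_poly" and A :: "'k ^ 3 ^ 3"
  assumes F: "homogeneous_of_degree d F" "nonsingular_form F" and d: "d \<ge> 3"
    and A: "\<And>x. eval_poly F (A *v x) = l * eval_poly F x" and l: "l \<noteq> 0"
    and v: "v \<noteq> 0" "A *v v = v" and w: "A *v w = w + v"
  shows False
proof -
  have A_line: "A *v (w + t *s v) = w + (1 + t) *s v" for t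
    by (simp add: matrix_vector_right_distrib matrix_vector_mult_scale v w vec_eq_iff algebra_simps)
  have "poly (pcompose (line_poly F w v) [:1, 1:]) t = poly (smult l (line_poly F w v)) t" for t
    using A[of "w + t *s v"] unfolding A_line by (simp add: poly_pcompose poly_line_poly)
  then have "[:0:] + smult 1 (pcompose (line_poly F w v) [:1, 1:]) = smult l (line_poly F w v)"
    by (simp add: poly_eq_poly_eq_iff[symmetric] fun_eq_iff)
  from degree_shift_equation(2)[OF this l] obtain c where "line_poly F w v = [:c:]"
    by (auto elim: degree_eq_zeroE)
  then have c: "eval_poly F (w + t *s v) = c" for t by (simp add: poly_line_poly[symmetric])
  have line_vw: "line_poly F v w = monom c d" by (rule line_poly_swap[OF F(1) c])
  have "polar F v w = 0"
    using d unfolding coeff_1_line_poly[symmetric] line_vw by simp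
  have "eval_poly F v = poly (line_poly F v w) 0" by (simp add: poly_line_poly)
  then have "eval_poly F v = 0" unfolding line_vw using d by (simp add: poly_monom)
  then have "polar F v v = 0" by (simp add: polar_self[OF F(1)])
  have shift: "w + t *s v + s *s v = w + (t + s) *s v" for s t
    by (simp add: vec_eq_iff algebra_simps)
  have pv: "polar F (w + t *s v) v = 0" for t
    by (rule polar_eq_0_if_constant[where c = c]) (simp only: shift c)
  have pw: "polar F (w + t *s v) w = of_nat d * c" for t
    using polar_self[OF F(1), of "w + t *s v"] by (simp add: polar_add polar_scale pv c)
  have "w \<notin> vec.span {v}"
  proof
    assume "w \<in> vec.span {v}"
    then obtain k where "w = k *s v" by (auto simp: vec.span_singleton)
    then have "A *v w = w" using v by (simp add: matrix_vector_mult_scale)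
    with w v show False by simp
  qed
  then obtain e where e: "vec.span {v, w, e} = UNIV" using extend_pair_to_basis v(1) by blast
  then obtain x y z where Ae: "A *v e = x *s v + y *s w + z *s e"
    by (metis UNIV_I span_3_iff)
  define h where "h = polar_line_poly F w v e"
  \<comment> \<open>Expand \<open>A *v e\<close> in the basis: along the line the differential is 0
    in the direction \<open>v\<close> and constantly d c in the direction \<open>w\<close>, so a
    shift equation for \<open>h\<close> remains.\<close>
  have "poly ([:y * (of_nat d * c):] + smult z (pcompose h [:1, 1:])) t = poly (smult l h) t" for t
  proof -
    have "polar F (w + (1 + t) *s v) (x *s v + y *s w + z *s e) =
        y * (of_nat d * c) + z * polar F (w + (1 + t) *s v) e"
      by (simp only: polar_add polar_scale pv pw) simp
    moreover have "\<dots> = poly ([:y * (of_nat d * c):] + smult z (pcompose h [:1, 1:])) t"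
      unfolding h_def by (simp only: poly_polar_line_poly poly_pcompose poly_add poly_smult poly_pCons poly_0) simp
    ultimately show ?thesis
      using polar_invariant[OF A, of "w + t *s v" e]
      unfolding A_line Ae by (simp only: h_def poly_smult poly_polar_line_poly)
  qed
  then have "[:y * (of_nat d * c):] + smult z (pcompose h [:1, 1:]) = smult l h"
    by (intro poly_eqI_nonzero)
  \<comment> \<open>Here d >= 3 matters: d - 1 exceeds the degree bound 1.\<close>
  from degree_shift_equation(1)[OF this l] have "coeff h (d - 1) = 0"
    using d by (intro coeff_eq_0) simp
  then have "polar F v e = 0" unfolding h_def coeff_polar_line_poly[OF F(1)] .
  then have "polar F v u = 0" for u
    using polar_eq_0_if_spanning[OF e] \<open>polar F v v = 0\<close> \<open>polar F v w = 0\<close> by blast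
  moreover have "\<exists>u. polar F v u \<noteq> 0"
    using nonsingular_imp_polar_nonzero[OF F _ v(1)] d by simp
  ultimately show False by blast
qed

text \<open>Dividing both \<open>A\<close> and \<open>v\<close> by the eigenvalue reduces to the
  unipotent case.\<close>

lemma no_jordan_chain:
  fixes F :: "'k::field_char_0 ternary_poly" and A :: "'k ^ 3 ^ 3"
  assumes F: "homogeneous_of_degree d F" "nonsingular_form F" and d: "d \<ge> 3"
    and A: "\<And>x. eval_poly F (A *v x) = l * eval_poly F x" and l: "l \<noteq> 0"
    and v: "v \<noteq> 0" "A *v v = a *s v" and w: "A *v w = a *s w + v" and a: "a \<noteq> 0"
  shows False
proof (rule no_unipotent_chain[OF F d])
  have B: "(mat (1 / a) ** A) *v x = (1 / a) *s (A *v x)" for x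
  proof -
    have "mat (1 / a) *v y = (1 / a) *s y" for y :: "'k ^ 3"
      by (simp add: matrix_vector_mult_def mat_def vec_eq_iff mult_delta_left)
    then show ?thesis by (simp only: matrix_vector_mul_assoc[symmetric])
  qed
  show "eval_poly F ((mat (1 / a) ** A) *v x) = ((1 / a) ^ d * l) * eval_poly F x" for x
    unfolding B eval_poly_scale[OF F(1)] A by simp
  show "(1 / a) ^ d * l \<noteq> 0" using a l by simp
  show "(1 / a) *s v \<noteq> 0" using a v(1) by simp
  show "(mat (1 / a) ** A) *v ((1 / a) *s v) = (1 / a) *s v"
    unfolding B matrix_vector_mult_scale v(2) using a by simp
  show "(mat (1 / a) ** A) *v w = w + (1 / a) *s v"
    unfolding B w using a by (simp add: vec_eq_iff field_simps)
qed

text \<open>Along a line lying in the curve, the differential in a transverse direction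
  \<open>e\<close> is a polynomial of positive degree, since \<open>w\<close> is not singular. It
  has a root, and the corresponding point of the line would be singular.\<close>

lemma line_poly_nonzero:
  fixes F :: "'k::{alg_closed_field, field_char_0} ternary_poly"
  assumes F: "homogeneous_of_degree d F" "nonsingular_form F" and d: "d \<ge> 2"
    and v: "v \<noteq> 0" and w: "w \<notin> vec.span {v}"
  shows "line_poly F v w \<noteq> 0"
proof
  assume z: "line_poly F v w = 0"
  then have Fz: "eval_poly F (v + t *s w) = 0" for t
    by (simp add: poly_line_poly[symmetric])
  have wv: "line_poly F w v = 0" using line_poly_swap[OF F(1) Fz] by simp
  have "eval_poly F w = 0" using z coeff_line_poly[OF F(1), of v w] by simp
  then have "polar F w w = 0" by (simp add: polar_self[OF F(1)])
  have "polar F w v = 0" using wv by (simp add: coeff_1_line_poly[symmetric])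
  have "w \<noteq> 0" using w vec.span_zero by metis
  obtain e where e: "vec.span {v, w, e} = UNIV" using extend_pair_to_basis v w by blast
  define h where "h = polar_line_poly F v w e"
  have nz: "\<exists>u. polar F x u \<noteq> 0" if "x \<noteq> 0" for x
    using nonsingular_imp_polar_nonzero[OF F _ that] d by simp
  then have "polar F w e \<noteq> 0"
    using polar_eq_0_if_spanning[OF e] \<open>polar F w w = 0\<close> \<open>polar F w v = 0\<close> \<open>w \<noteq> 0\<close> by blast
  then have "coeff h (d - 1) \<noteq> 0" unfolding h_def coeff_polar_line_poly[OF F(1)] .
  then have "degree h > 0" using d le_degree[of h "d - 1"] by simp
  then obtain t where t: "poly h t = 0" using alg_closed_imp_poly_has_root by blast
  define x where "x = v + t *s w"
  have "polar F x e = 0" using t by (simp add: h_def poly_polar_line_poly x_def)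
  have shift: "x + s *s w = v + (t + s) *s w" for s by (simp add: x_def vec_eq_iff algebra_simps)
  have "polar F x w = 0"
    by (rule polar_eq_0_if_constant[where c = 0]) (simp only: shift Fz)
  have "polar F x x = 0" using Fz[of t] by (simp add: polar_self[OF F(1)] x_def)
  then have "polar F x v = 0" using \<open>polar F x w = 0\<close>
    by (metis add.right_neutral mult_zero_right polar_add polar_scale x_def)
  have "x \<noteq> 0"
  proof
    assume "x = 0"
    then have eq: "v = (- t) *s w" unfolding x_def by (simp add: eq_neg_iff_add_eq_0)
    then have "t \<noteq> 0" using v by auto
    then have "w = (- 1 / t) *s v" unfolding eq by (simp add: vec_eq_iff)
    then have "w \<in> vec.span {v}" by (metis insertI1 vec.span_base vec.span_scale)
    with w show False by simp
  qed
  with nz polar_eq_0_if_spanning[OF e] \<open>polar F x v = 0\<close> \<open>polar F x w = 0\<close> \<open>polar F x e = 0\<close>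
  show False by blast
qed

section \<open>Eigenbases and monomial patterns\<close>

definition poly_apply :: "'k::field poly \<Rightarrow> 'k ^ 'n ^ 'n \<Rightarrow> 'k ^ 'n \<Rightarrow> 'k ^ 'n" where
  "poly_apply p A v = (\<Sum>i\<le>degree p. coeff p i *s (((*v) A) ^^ i) v)"

lemma poly_apply_le_degree:
  assumes "degree p \<le> n"
  shows "poly_apply p A v = (\<Sum>i\<le>n. coeff p i *s (((*v) A) ^^ i) v)"
  unfolding poly_apply_def
  by (rule sum.mono_neutral_left) (use assms in \<open>auto simp: coeff_eq_0\<close>)

lemma poly_apply_0 [simp]: "poly_apply 0 A v = 0"
  by (simp add: poly_apply_def)

lemma poly_apply_add: "poly_apply (p + q) A v = poly_apply p A v + poly_apply q A v"
proof -
  let ?n = "max (degree p) (degree q)"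
  have "degree (p + q) \<le> ?n" by (rule degree_add_le_max)
  then show ?thesis
    by (simp add: poly_apply_le_degree[of _ ?n] vec.scale_left_distrib sum.distrib)
qed

lemma poly_apply_smult: "poly_apply (smult c p) A v = c *s poly_apply p A v"
  by (subst poly_apply_le_degree[OF degree_smult_le])
    (simp add: poly_apply_def vec.scale_sum_right)

lemma matrix_vector_mult_sum: "A *v sum f S = (\<Sum>i\<in>S. A *v f i)"
  for A :: "'a::comm_ring_1 ^ 'n ^ 'm"
  by (induction S rule: infinite_finite_induct) (simp_all add: matrix_vector_right_distrib)

lemma poly_apply_pCons: "poly_apply (pCons c p) A v = c *s v + A *v poly_apply p A v"
proof -
  have "poly_apply (pCons c p) A v = (\<Sum>i\<le>Suc (degree p). coeff (pCons c p) i *s (((*v) A) ^^ i) v)"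
    by (rule poly_apply_le_degree) (rule degree_pCons_le)
  also have "\<dots> = c *s v + (\<Sum>i\<le>degree p. coeff p i *s (A *v (((*v) A) ^^ i) v))"
    by (subst sum.atMost_Suc_shift) simp
  also have "\<dots> = c *s v + A *v poly_apply p A v"
    by (simp add: poly_apply_def matrix_vector_mult_sum matrix_vector_mult_scale)
  finally show ?thesis .
qed

lemma poly_apply_linear_factor:
  "poly_apply ([:- a, 1:] * q) A v = A *v poly_apply q A v - a *s poly_apply q A v"
proof -
  have "[:- a, 1:] * q = smult (- a) q + pCons 0 q" by simp
  then show ?thesis
    by (simp only: poly_apply_add poly_apply_smult poly_apply_pCons) (simp add: vec.scale_minus_left)
qed

lemma exists_annihilating_poly:
  fixes A :: "'k::field ^ 'n ^ 'n"
  obtains p where "p \<noteq> 0" "poly_apply p A v = 0"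
proof -
  let ?f = "\<lambda>i. (((*v) A) ^^ i) v"
  have "\<exists>n. ?f n \<in> vec.span (?f ` {..<n})"
  proof (rule ccontr)
    assume "\<nexists>n. ?f n \<in> vec.span (?f ` {..<n})"
    then have notin: "?f n \<notin> vec.span (?f ` {..<n})" for n by blast
    have ind: "vec.independent (?f ` {..<n}) \<and> card (?f ` {..<n}) = n" for n
    proof (induction n)
      case (Suc n)
      have "?f n \<notin> ?f ` {..<n}"
        using notin[of n] vec.span_base[of "?f n" "?f ` {..<n}"] by (rule contrapos_nn)
      then show ?case using Suc notin[of n] by (simp add: lessThan_Suc vec.independent_insertI)
    qed (simp add: vec.independent_empty)
    have "Suc CARD('n) = vec.dim (?f ` {..<Suc CARD('n)})"
      unfolding vec.dim_eq_card_independent[OF conjunct1[OF ind]] by (rule conjunct2[OF ind, symmetric])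
    also have "\<dots> \<le> CARD('n)" by (rule dim_subset_UNIV_cart_gen)
    finally show False by simp
  qed
  then obtain n where n: "?f n \<in> vec.span (?f ` {..<n})" ..
  \<comment> \<open>Keeping the coefficient at \<open>n\<close> equal to 0 ensures that X^n - p is
    not the zero polynomial.\<close>
  have "\<exists>p. coeff p n = 0 \<and> x = poly_apply p A v" if "x \<in> vec.span (?f ` {..<n})" for x
    using that
  proof (induction rule: vec.span_induct_alt)
    case base
    show ?case by (rule exI[of _ 0]) simp
  next
    case (step c x y)
    then obtain p i where p: "coeff p n = 0" "y = poly_apply p A v" and i: "i < n" "x = ?f i" by auto
    have "poly_apply (monom 1 i) A v = ?f i" for i
      by (induction i) (simp_all add: monom_0 monom_Suc poly_apply_pCons)
    then have "c *s x + y = poly_apply (smult c (monom 1 i) + p) A v"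
      by (simp add: poly_apply_add poly_apply_smult p i)
    moreover have "coeff (smult c (monom 1 i) + p) n = 0" using p i by simp
    ultimately show ?case by blast
  qed
  with n obtain p where p: "coeff p n = 0" "?f n = poly_apply p A v" by blast
  have "poly_apply (monom 1 n) A v = ?f n"
    by (induction n) (simp_all add: monom_0 monom_Suc poly_apply_pCons)
  then have "poly_apply (monom 1 n + smult (- 1) p) A v = 0"
    unfolding poly_apply_add poly_apply_smult p(2) by simp
  moreover have "coeff (monom 1 n + smult (- 1) p) n = 1" using p(1) by simp
  then have "monom 1 n + smult (- 1) p \<noteq> 0" by (metis coeff_0 zero_neq_one)
  ultimately show thesis by (rule that[rotated])
qed

text \<open>Without Jordan chains, \<open>u\<close> lies in the span of the eigenvectors as soon as
  (A - a) u does. Peeling linear factors off a polynomial annihilating \<open>v\<close> therefore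
  brings \<open>v\<close> itself into the span.\<close>

lemma span_eigenvectors_eq_UNIV:
  fixes A :: "'k::alg_closed_field ^ 'n ^ 'n"
  assumes chain: "\<And>a v w. v \<noteq> 0 \<Longrightarrow> A *v v = a *s v \<Longrightarrow> A *v w = a *s w + v \<Longrightarrow> False"
  shows "vec.span {v. \<exists>a. A *v v = a *s v} = UNIV"
proof -
  define E where "E = {v. \<exists>a. A *v v = a *s v}"
  \<comment> \<open>A - a is invertible on each eigenspace for another eigenvalue, so only an
    \<open>a\<close>-eigencomponent \<open>e\<close> (possibly 0) can fall outside the
    image.\<close>
  have split: "\<exists>t e. t \<in> vec.span E \<and> A *v e = a *s e \<and> s = A *v t - a *s t + e"
    if "s \<in> vec.span E" for s a
    using that
  proof (induction rule: vec.span_induct_alt)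
    case base
    show ?case by (intro exI[of _ 0]) (simp add: vec.span_zero)
  next
    case (step c x y)
    then obtain t e where te: "t \<in> vec.span E" "A *v e = a *s e" "y = A *v t - a *s t + e" by blast
    obtain b where b: "A *v x = b *s x" using step(1) by (auto simp: E_def)
    show ?case
    proof (cases "b = a")
      case True
      have "A *v (c *s x + e) = a *s (c *s x + e)"
        by (simp add: matrix_vector_right_distrib matrix_vector_mult_scale b te True vec_eq_iff algebra_simps)
      moreover have "c *s x + y = A *v t - a *s t + (c *s x + e)" by (simp add: te)
      ultimately show ?thesis using te(1) by blast
    next
      case False
      \<comment> \<open>Chosen so that (A - a) (k x) = c x, where \<open>x\<close> has eigenvalue
        \<open>b\<close>.\<close>
      define k where "k = c / (b - a)"
      have "c = k * (b - a)" unfolding k_def using False by simp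
      then have c: "c = k * b - k * a" by (simp only: right_diff_distrib)
      have "c *s x + y = A *v (k *s x + t) - a *s (k *s x + t) + e"
        unfolding c
        by (simp add: matrix_vector_right_distrib matrix_vector_mult_scale b te vec_eq_iff algebra_simps)
      moreover have "k *s x + t \<in> vec.span E"
        by (intro vec.span_add vec.span_scale te vec.span_base step)
      ultimately show ?thesis using te(2) by blast
    qed
  qed
  have pull: "u \<in> vec.span E" if "A *v u - a *s u \<in> vec.span E" for a u
  proof -
    from split[OF that] obtain t e where te: "t \<in> vec.span E" "A *v e = a *s e"
      "A *v u - a *s u = A *v t - a *s t + e" by metis
    \<comment> \<open>If \<open>e\<close> were nonzero, \<open>e\<close> and u - t would form a
      Jordan chain.\<close>
    have "A *v (u - t) = a *s (u - t) + e"
      using te(3) by (simp add: matrix_vector_mult_diff_distrib vec_eq_iff algebra_simps)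
    with chain[OF _ te(2)] have "e = 0" by blast
    with \<open>A *v (u - t) = _\<close> have "u - t \<in> E" by (auto simp: E_def)
    then have "(u - t) + t \<in> vec.span E" using te(1) by (intro vec.span_add[OF vec.span_base])
    then show ?thesis by simp
  qed
  have "v \<in> vec.span E" if "p \<noteq> 0" "poly_apply p A v \<in> vec.span E" for p v
    using that
  proof (induction "degree p" arbitrary: p)
    case 0
    then obtain c where c: "p = [:c:]" "c \<noteq> 0" by (metis degree_eq_zeroE pCons_0_0)
    then have "c *s v \<in> vec.span E" using 0 by (simp add: poly_apply_pCons)
    then have "(1 / c) *s (c *s v) \<in> vec.span E" by (rule vec.span_scale)
    then show ?case using c by simp
  next
    case (Suc n)
    then have "degree p > 0" by simp
    then obtain a where "poly p a = 0" using alg_closed_imp_poly_has_root by blast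
    then obtain q where q: "p = [:- a, 1:] * q" using poly_eq_0_iff_dvd[of p a] by (auto elim: dvdE)
    with Suc.prems have "q \<noteq> 0" by auto
    then have "degree p = degree [:- a, 1:] + degree q" unfolding q by (intro degree_mult_eq) auto
    then have "n = degree q" using Suc.hyps(2) by simp
    moreover have "poly_apply q A v \<in> vec.span E"
      using Suc.prems(2) unfolding q poly_apply_linear_factor by (rule pull)
    ultimately show ?case using Suc.hyps(1) \<open>q \<noteq> 0\<close> by blast
  qed
  moreover have "\<exists>p. p \<noteq> 0 \<and> poly_apply p A v \<in> vec.span E" for v
    using exists_annihilating_poly[of A v] vec.span_zero by metis
  ultimately show ?thesis unfolding E_def[symmetric] by blast
qed

lemma eigenbasis:
  fixes A :: "'k::alg_closed_field ^ 3 ^ 3"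
  assumes "\<And>a v w. v \<noteq> 0 \<Longrightarrow> A *v v = a *s v \<Longrightarrow> A *v w = a *s w + v \<Longrightarrow> False"
  obtains v :: "3 \<Rightarrow> 'k ^ 3" and e where "\<And>i. A *v v i = e i *s v i" "inj v"
    "vec.independent (range v)" "vec.span (range v) = UNIV"
proof -
  let ?E = "{v. \<exists>a. A *v v = a *s v}"
  obtain B where B: "B \<subseteq> ?E" "vec.independent B" "?E \<subseteq> vec.span B"
    using vec.maximal_independent_subset[of ?E] by blast
  have "vec.span ?E \<subseteq> vec.span B" using vec.span_mono[OF B(3)] by (simp add: vec.span_span)
  then have sp: "vec.span B = UNIV" using span_eigenvectors_eq_UNIV[of A] assms by auto
  then have "card B = 3"
    using vec.dim_eq_card[of B UNIV] B(2) vec_dim_card[where 'a = 'k and 'n = 3] by simp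
  moreover from this have "finite B" using card.infinite by fastforce
  ultimately have "\<exists>v. bij_betw v (UNIV :: 3 set) B"
    by (intro finite_same_card_bij) simp_all
  then obtain v :: "3 \<Rightarrow> 'k ^ 3" where v: "bij_betw v UNIV B" ..
  have "v i \<in> ?E" for i using bij_betwE[OF v] B(1) by blast
  then have "\<forall>i. \<exists>a. A *v v i = a *s v i" by blast
  then obtain e where "\<And>i. A *v v i = e i *s v i" by metis
  then show thesis using v B sp by (intro that[of v e]) (auto simp: bij_betw_def)
qed

text \<open>
  The orders come from the possible patterns \<open>i \<mapsto> j\<close> of monomials \<open>x\<^sub>i\<^sup>n x\<^sub>j\<close> (\<open>n = d - 1\<close>),
  one for each \<open>i\<close>, that nonsingularity at the coordinate points forces to occur.
\<close>

lemma monomial_pattern_orders: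
  fixes e :: "3 \<Rightarrow> 'k::field"
  assumes nz: "\<And>i. e i \<noteq> 0" "l \<noteq> 0" and n: "n \<ge> 3"
    and point: "\<And>i. \<exists>j. e i ^ n * e j = l"
    and line: "\<And>i j. i \<noteq> j \<Longrightarrow> \<exists>k\<le>Suc n. e i ^ (Suc n - k) * e j ^ k = l"
  shows "\<exists>N\<in>{n, Suc n, n\<^sup>2 - n + 1, n\<^sup>2, Suc n * (n - 1), Suc n * n}. \<forall>i j. e i ^ N = e j ^ N"
    (is "?Q")
proof -
  have Q: ?Q if "{i, j, k} = (UNIV :: 3 set)" "e j ^ N = e i ^ N" "e k ^ N = e i ^ N"
    "N \<in> {n, Suc n, n\<^sup>2 - n + 1, n\<^sup>2, Suc n * (n - 1), Suc n * n}" for i j k N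
  proof -
    have pow: "e m ^ N = e i ^ N" for m
    proof -
      have "m \<in> {i, j, k}" using that(1) by simp
      then show ?thesis using that(2,3) by auto
    qed
    have "e x ^ N = e y ^ N" for x y unfolding pow[of x] pow[of y] ..
    then show ?thesis using that(4) by blast
  qed
  \<comment> \<open>In the names of the seven cases the letters give, in turn, the images of i, j
    and k, with f marking an index sent to itself. Up to relabelling these are all the self-maps of
    a set of three elements.\<close>
  have fff: ?Q if "e i ^ n * e i = l" "e j ^ n * e j = l" "e k ^ n * e k = l"
    "{i, j, k} = (UNIV :: 3 set)" for i j k
    by (rule Q[OF that(4), of "Suc n"]) (use that in \<open>simp_all add: mult.commute\<close>)
  have ffi: ?Q if "e i ^ n * e i = l" "e j ^ n * e j = l" "e k ^ n * e i = l"
    "{i, j, k} = (UNIV :: 3 set)" for i j k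
  proof (rule Q[OF that(4), of "Suc n * n"])
    have "e k ^ n = e i ^ n" using that nz by (metis mult_right_cancel)
    then show "e k ^ (Suc n * n) = e i ^ (Suc n * n)" by (metis mult.commute power_mult)
    have "e j ^ Suc n = e i ^ Suc n" using that by (simp add: mult.commute)
    then show "e j ^ (Suc n * n) = e i ^ (Suc n * n)" by (simp only: power_mult)
  qed simp
  have fii: ?Q if "e i ^ n * e i = l" "e j ^ n * e i = l" "e k ^ n * e i = l"
    "{i, j, k} = (UNIV :: 3 set)" for i j k
    by (rule Q[OF that(4), of n]) (use that nz in \<open>metis mult_right_cancel\<close>, use that nz in \<open>metis mult_right_cancel\<close>, simp)
  have fij: ?Q if "e i ^ n * e i = l" "e j ^ n * e i = l" "e k ^ n * e j = l"
    "{i, j, k} = (UNIV :: 3 set)" for i j k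
  proof (rule Q[OF that(4), of "n\<^sup>2"])
    have ji: "e j ^ n = e i ^ n" using that nz by (metis mult_right_cancel)
    then show "e j ^ n\<^sup>2 = e i ^ n\<^sup>2" by (simp only: power2_eq_square power_mult)
    have "(e k ^ n * e j) ^ n = (e i ^ n * e i) ^ n" using that by simp
    then have "e k ^ n\<^sup>2 * e i ^ n = e i ^ n\<^sup>2 * e i ^ n"
      by (simp only: power_mult_distrib power_mult[symmetric] power2_eq_square ji)
    then show "e k ^ n\<^sup>2 = e i ^ n\<^sup>2" using nz by simp
  qed simp
  have fkj: ?Q if "e i ^ n * e i = l" "e j ^ n * e k = l" "e k ^ n * e j = l"
    "{i, j, k} = (UNIV :: 3 set)" for i j k
  proof (rule Q[OF that(4), of "Suc n * (n - 1)"])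
    obtain m where m: "n = Suc m" using n by (cases n) auto
    \<comment> \<open>Swapped indices have equal powers of exponent n - 1, so raising the relation
      to that exponent allows \<open>e y\<close> to be replaced by \<open>e x\<close>.\<close>
    have key: "e x ^ (Suc n * (n - 1)) = e i ^ (Suc n * (n - 1))"
      if "e x ^ n * e y = e i ^ n * e i" "e x ^ n * e y = e y ^ n * e x" for x y
    proof -
      have "e x ^ m = e y ^ m"
        using that(2) nz(1) by (simp add: m mult_ac)
      have "(e x ^ n * e y) ^ m = (e i ^ n * e i) ^ m" using that by simp
      then have "(e x ^ n * e x) ^ m = (e i ^ n * e i) ^ m"
        unfolding power_mult_distrib \<open>e x ^ m = e y ^ m\<close> .
      then have "e x ^ (Suc n * m) = e i ^ (Suc n * m)"
        by (simp only: power_Suc2[symmetric] power_mult[symmetric])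
      moreover have "n - 1 = m" by (simp add: m)
      ultimately show ?thesis by simp
    qed
    show "e j ^ (Suc n * (n - 1)) = e i ^ (Suc n * (n - 1))" by (rule key[of j k]) (use that in simp_all)
    show "e k ^ (Suc n * (n - 1)) = e i ^ (Suc n * (n - 1))" by (rule key[of k j]) (use that in simp_all)
  qed simp
  have jki: ?Q if "e i ^ n * e j = l" "e j ^ n * e k = l" "e k ^ n * e i = l"
    "{i, j, k} = (UNIV :: 3 set)" for i j k
  proof (rule Q[OF that(4), of "n\<^sup>2 - n + 1"])
    obtain m where m: "n = Suc m" using n by (cases n) auto
    have N: "n\<^sup>2 - n + 1 = Suc (n * m)" by (simp add: m power2_eq_square)
    \<comment> \<open>The exponent is n (n - 1) + 1: it appears when \<open>e z\<close> is
      eliminated from the relations of the 3-cycle and common factors are cancelled.\<close>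
    have key: "e y ^ (n\<^sup>2 - n + 1) = e x ^ (n\<^sup>2 - n + 1)"
      if "e x ^ n * e y = l" "e y ^ n * e z = l" "e z ^ n * e x = l" for x y z
    proof -
      have xn: "e x ^ n = e x ^ m * e x" by (simp add: m)
      have "e z ^ n * e x = e x ^ n * e y" using that by simp
      also have "\<dots> = (e x ^ m * e y) * e x" by (simp only: xn mult_ac)
      finally have zn: "e z ^ n = e x ^ m * e y" using nz(1) by simp
      have "(e y ^ n * e z) ^ n = (e x ^ n * e y) ^ n" using that by simp
      then have "(e y ^ n) ^ n * (e x ^ m * e y) = (e x ^ n) ^ n * e y ^ n"
        by (simp add: power_mult_distrib zn)
      then have "(e y ^ n) ^ m * e y * (e y ^ n * e x ^ m) = (e x ^ n) ^ m * e x * (e y ^ n * e x ^ m)"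
        by (simp add: m mult_ac)
      then have "(e y ^ n) ^ m * e y = (e x ^ n) ^ m * e x" using nz(1) by simp
      then show ?thesis unfolding N by (simp only: power_Suc2 power_mult)
    qed
    show "e j ^ (n\<^sup>2 - n + 1) = e i ^ (n\<^sup>2 - n + 1)" by (rule key[OF that(1-3)])
    show "e k ^ (n\<^sup>2 - n + 1) = e i ^ (n\<^sup>2 - n + 1)"
      by (rule key[OF that(3,1,2), symmetric])
  qed simp
  \<comment> \<open>The three monomials alone give order \<open>(d - 1) (d - 2)\<close>; one more monomial, on the line
    \<open>x\<^sub>i = 0\<close>, is needed.\<close>
  have jii: ?Q if "e i ^ n * e j = l" "e j ^ n * e i = l" "e k ^ n * e i = l"
    "{i, j, k} = (UNIV :: 3 set)" for i j k
  proof (rule Q[OF that(4), of n])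
    have kj: "e k ^ n = e j ^ n" using that nz by (metis mult_right_cancel)
    have "j \<noteq> k"
    proof
      assume "j = k"
      then have "card (UNIV :: 3 set) = card {i, k}" using that(4) by simp
      moreover have "card {i, k} \<le> 2" by (simp add: card_insert_if)
      ultimately show False by simp
    qed
    then obtain m where m: "m \<le> Suc n" "e j ^ (Suc n - m) * e k ^ m = l" using line by blast
    \<comment> \<open>Because \<open>e j\<close> and \<open>e k\<close> have the same
      \<open>n\<close>-th power, the \<open>n\<close>-th power of the extra monomial does not depend
      on \<open>m\<close>.\<close>
    have "(e j ^ (Suc n - m) * e k ^ m) ^ n = (e j ^ n * e i) ^ n" using m that by simp
    moreover have "(e j ^ (Suc n - m) * e k ^ m) ^ n = (e j ^ n) ^ (Suc n - m) * (e k ^ n) ^ m"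
      by (simp add: power_mult_distrib power_mult[symmetric] mult.commute)
    ultimately have "(e j ^ n) ^ Suc n = (e j ^ n) ^ n * e i ^ n"
      using m(1) by (auto simp: kj power_add[symmetric] power_mult_distrib)
    then show ji: "e j ^ n = e i ^ n" using nz(1) by auto
    from ji kj show "e k ^ n = e i ^ n" by simp
  qed simp
  have UNIV_perm: "{i, j, k} = (UNIV :: 3 set)"
    if "(i, j, k) \<in> {(1, 2, 3), (1, 3, 2), (2, 1, 3), (2, 3, 1), (3, 1, 2), (3, 2, 1)}" for i j k
    using that by (auto simp: UNIV_3)
  have cases: "e i ^ n * e 1 = l \<or> e i ^ n * e 2 = l \<or> e i ^ n * e 3 = l" for i
    using point[of i] by (metis exhaust_3)
  \<comment> \<open>Each of the 27 choices matches one of the seven patterns after a permutation of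
    the indices.\<close>
  show ?thesis
    using cases[of 1] cases[of 2] cases[of 3]
    by (elim disjE)
      ((rule fff ffi fii fij fkj jki jii, assumption, assumption, assumption, rule UNIV_perm, simp; fail)+)
qed

section \<open>Orders of automorphisms\<close>

lemma diagonal_power_scalar:
  fixes A :: "'k::field ^ 'n ^ 'n" and v :: "'i \<Rightarrow> 'k ^ 'n"
  assumes eig: "\<And>i. A *v v i = e i *s v i" and span: "vec.span (range v) = UNIV"
    and N: "\<And>i. e i ^ N = s"
  shows "(((*v) A) ^^ N) x = s *s x"
proof -
  have pow: "(((*v) A) ^^ m) (v i) = e i ^ m *s v i" for m i
    by (induction m) (simp_all add: matrix_vector_mult_scale eig mult.commute)
  have lin: "(((*v) A) ^^ m) (c *s x + y) = c *s (((*v) A) ^^ m) x + (((*v) A) ^^ m) y" for m c x y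
    by (induction m) (simp_all add: matrix_vector_mult_scale matrix_vector_right_distrib)
  have zero: "(((*v) A) ^^ m) 0 = 0" for m by (induction m) simp_all
  have "x \<in> vec.span (range v)" by (simp add: span)
  then show ?thesis
  proof (induction rule: vec.span_induct_alt)
    case (step c x y)
    then obtain i where "x = v i" by blast
    then have "(((*v) A) ^^ N) x = s *s x" by (simp add: pow N)
    then show ?case unfolding lin step(2) by (simp add: vec_eq_iff algebra_simps)
  qed (simp add: zero)
qed

lemma preserved_nonsingular_form_imp_power_scalar:
  fixes F :: "'k::{alg_closed_field, field_char_0} ternary_poly" and A :: "'k ^ 3 ^ 3"
  assumes F: "homogeneous_of_degree d F" "nonsingular_form F" and d: "d \<ge> 4"
    and A: "invertible A" "\<And>x. eval_poly F x = 0 \<Longrightarrow> eval_poly F (A *v x) = 0"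
  obtains N s where "N \<in> {d - 1, d, d\<^sup>2 - 3 * d + 3, (d - 1)\<^sup>2, d * (d - 2), d * (d - 1)}"
    "s \<noteq> 0" "\<And>x. (((*v) A) ^^ N) x = s *s x"
proof -
  have "d > 0" using d by simp
  obtain l where l: "\<And>x. eval_poly F (A *v x) = l * eval_poly F x"
    using nonsingular_form_preserved_up_to_scalar[OF F \<open>d > 0\<close> A(2)] by metis
  obtain B where B: "A ** B = mat 1" "B ** A = mat 1" using A(1) by (auto simp: invertible_def)
  have AB: "A *v (B *v x) = x" and BA: "B *v (A *v x) = x" for x
    by (simp_all add: matrix_vector_mul_assoc B)
  have "l \<noteq> 0"
  proof
    assume "l = 0"
    obtain v where "eval_poly F v \<noteq> 0" using nonsingular_imp_nonzero_value[OF F \<open>d > 0\<close>] .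
    then show False using l[of "B *v v"] \<open>l = 0\<close> by (simp add: AB)
  qed
  have eig_nz: "a \<noteq> 0" if "v \<noteq> 0" "A *v v = a *s v" for a v
  proof
    assume "a = 0"
    then have "B *v (A *v v) = 0" using that(2) by simp
    with BA that(1) show False by simp
  qed
  have "d \<ge> 3" using d by simp
  obtain v :: "3 \<Rightarrow> 'k ^ 3" and e where eig: "\<And>i. A *v v i = e i *s v i" and inj: "inj v"
    and indep: "vec.independent (range v)" and span: "vec.span (range v) = UNIV"
  proof (rule eigenbasis[of A])
    show False if "v \<noteq> 0" "A *v v = a *s v" "A *v w = a *s w + v" for a v w
      using no_jordan_chain[OF F \<open>d \<ge> 3\<close> l \<open>l \<noteq> 0\<close> that eig_nz[OF that(1,2)]] .
  qed blast
  have v_nz: "v i \<noteq> 0" for i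
    using indep vec.dependent_zero by (metis rangeI)
  have e_nz: "e i \<noteq> 0" for i using eig_nz[OF v_nz eig] .
  \<comment> \<open>A nonzero coefficient is a monomial present in \<open>F\<close> in
    eigencoordinates; invariance of \<open>F\<close> up to \<open>l\<close> then fixes the value of
    that monomial at the eigenvalues.\<close>
  have transport: "e i ^ (d - k) * e j ^ k = l"
    if "coeff (line_poly F (v i) (v j)) k \<noteq> 0" "k \<le> d" for i j k
  proof -
    have "line_poly F (e i *s v i) (e j *s v j) = smult l (line_poly F (v i) (v j))"
      using line_poly_invariant[of F A l "v i" "v j"] l by (simp add: eig)
    then have "e i ^ (d - k) * e j ^ k * coeff (line_poly F (v i) (v j)) k = l * coeff (line_poly F (v i) (v j)) k"
      using coeff_line_poly_scale[OF F(1) e_nz that(2), of i "v i" "e j" "v j"] by auto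
    then show ?thesis using mult_right_cancel[OF that(1)] by blast
  qed
  have "\<exists>N\<in>{d - 1, Suc (d - 1), (d - 1)\<^sup>2 - (d - 1) + 1, (d - 1)\<^sup>2, Suc (d - 1) * (d - 1 - 1),
      Suc (d - 1) * (d - 1)}. \<forall>i j. e i ^ N = e j ^ N"
  proof (rule monomial_pattern_orders[OF e_nz \<open>l \<noteq> 0\<close>])
    show "d - 1 \<ge> 3" using d by simp
    show "\<exists>j. e i ^ (d - 1) * e j = l" for i
    proof -
      have "\<exists>j. polar F (v i) (v j) \<noteq> 0"
      proof (rule ccontr)
        assume "\<nexists>j. polar F (v i) (v j) \<noteq> 0"
        moreover have "vec.span {v 1, v 2, v 3} = UNIV"
          using span unfolding UNIV_3 by simp
        ultimately have "polar F (v i) w = 0" for w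
          using polar_eq_0_if_spanning[of "v 1" "v 2" "v 3" F "v i"] by blast
        then show False using nonsingular_imp_polar_nonzero[OF F \<open>d > 0\<close> v_nz] by blast
      qed
      \<comment> \<open>The case j = i is included: the linear coefficient of F(v + t v) is d F(v),
        and the relation becomes that of the pure power.\<close>
      then obtain j where "coeff (line_poly F (v i) (v j)) 1 \<noteq> 0"
        unfolding coeff_1_line_poly by blast
      from transport[OF this] show ?thesis using d by auto
    qed
    show "\<exists>k\<le>Suc (d - 1). e i ^ (Suc (d - 1) - k) * e j ^ k = l" if "i \<noteq> j" for i j
    proof -
      have "v j \<notin> vec.span {v i}"
      proof
        assume "v j \<in> vec.span {v i}"
        moreover have "{v i} \<subseteq> range v - {v j}" using injD[OF inj, of i j] that by auto
        ultimately have "v j \<in> vec.span (range v - {v j})" using vec.span_mono by blast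
        then show False using indep unfolding vec.dependent_def by blast
      qed
      then have nz: "line_poly F (v i) (v j) \<noteq> 0"
        using line_poly_nonzero[OF F _ v_nz] d by simp
      define k where "k = degree (line_poly F (v i) (v j))"
      have "k \<le> d" unfolding k_def by (rule degree_line_poly[OF F(1)])
      moreover have "coeff (line_poly F (v i) (v j)) k \<noteq> 0" using nz by (simp add: k_def)
      ultimately show ?thesis using transport[of i j k] d by auto
    qed
  qed
  moreover have "(d - 1)\<^sup>2 - (d - 1) + 1 = d\<^sup>2 - 3 * d + 3"
  proof -
    obtain m where m: "d = m + 3" using d by (metis add.commute le_Suc_ex numeral_le_iff le_trans semiring_norm(69) \<open>d \<ge> 3\<close>)
    have "d\<^sup>2 - 3 * d = m * m + 3 * m" "(d - 1)\<^sup>2 - (d - 1) = m * m + 3 * m + 2"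
      by (simp_all add: m power2_eq_square algebra_simps)
    then show ?thesis by simp
  qed
  moreover have "Suc (d - 1) = d" "d - 1 - 1 = d - 2" using d by simp_all
  ultimately obtain N where N: "N \<in> {d - 1, d, d\<^sup>2 - 3 * d + 3, (d - 1)\<^sup>2, d * (d - 2), d * (d - 1)}"
    "\<And>i j. e i ^ N = e j ^ N" by metis
  have "e i ^ N = e 1 ^ N" for i by (rule N(2))
  from diagonal_power_scalar[OF eig span this] have "(((*v) A) ^^ N) x = (e 1 ^ N) *s x" for x .
  then show thesis using that[OF N(1), of "e 1 ^ N"] e_nz by simp
qed

section \<open>From matrices to classes in PGL_3 and automorphisms of the curve\<close>

lemma PGL3_carrierE:
  assumes "\<sigma> \<in> carrier (PGL3 :: ('k::field ^ 3 ^ 3) set monoid)"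
  obtains A where "invertible A" "\<sigma> = scalar_matrices #>\<^bsub>GL3\<^esub> A"
  using assms by (auto simp: PGL3_def FactGroup_def RCOSETS_def GL3_def)

lemma mem_scalar_coset: "A \<in> scalar_matrices #>\<^bsub>GL3\<^esub> (A :: 'k::field ^ 3 ^ 3)"
proof -
  have "A = mat 1 ** A" by simp
  moreover have "mat 1 \<in> (scalar_matrices :: ('k ^ 3 ^ 3) set)"
    unfolding scalar_matrices_def by (rule CollectI) (rule exI[of _ 1], simp)
  ultimately show ?thesis unfolding r_coset_def GL3_def monoid.simps by blast
qed

lemma GL3_pow_mult_vec: "(A [^]\<^bsub>GL3\<^esub> (n::nat)) *v x = (((*v) A) ^^ n) x"
  for A :: "'k::field ^ 3 ^ 3"
proof (induction n arbitrary: x)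
  case (Suc n)
  have "(A [^]\<^bsub>GL3\<^esub> Suc n) *v x = (A [^]\<^bsub>GL3\<^esub> n) *v (A *v x)"
    by (simp add: nat_pow_def GL3_def matrix_vector_mul_assoc)
  also have "\<dots> = (((*v) A) ^^ Suc n) x" by (simp only: Suc funpow_Suc_right o_apply)
  finally show ?case .
qed (simp add: nat_pow_def GL3_def)

lemma PGL3_coset_pow_eq_one:
  fixes A :: "'k::field ^ 3 ^ 3"
  assumes A: "invertible A" and s: "s \<noteq> 0" and N: "\<And>x. (((*v) A) ^^ N) x = s *s x"
  shows "(scalar_matrices #>\<^bsub>GL3\<^esub> A) [^]\<^bsub>PGL3\<^esub> N = \<one>\<^bsub>PGL3\<^esub>"
proof -
  interpret GL: group "GL3 :: ('k ^ 3 ^ 3) monoid" by (rule group_GL3)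
  interpret normal "scalar_matrices :: ('k ^ 3 ^ 3) set" GL3 by (rule normal_scalar_matrices)
  have AGL: "A \<in> carrier GL3" using A by (simp add: GL3_def)
  have "(A [^]\<^bsub>GL3\<^esub> N) *v x = mat s *v x" for x
    unfolding GL3_pow_mult_vec N
    by (simp add: matrix_vector_mult_def mat_def vec_eq_iff mult_delta_left)
  then have "A [^]\<^bsub>GL3\<^esub> N = mat s" by (simp add: matrix_eq)
  then have "A [^]\<^bsub>GL3\<^esub> N \<in> scalar_matrices" using s by (auto simp: scalar_matrices_def)
  then have "scalar_matrices #>\<^bsub>GL3\<^esub> (A [^]\<^bsub>GL3\<^esub> N) = scalar_matrices"
    by (intro GL.coset_join2) (simp_all add: AGL subgroup_axioms)
  moreover have "scalar_matrices #>\<^bsub>GL3\<^esub> (A [^]\<^bsub>GL3\<^esub> N) = (scalar_matrices #>\<^bsub>GL3\<^esub> A) [^]\<^bsub>PGL3\<^esub> N"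
    unfolding PGL3_def
    by (rule hom_nat_pow[OF r_coset_hom_Mod AGL group_GL3 factorgroup_is_group])
  ultimately show ?thesis by (simp add: PGL3_def FactGroup_def)
qed

text \<open>The image of a point of the curve is again the class of some zero of \<open>F\<close>,
  of which \<open>A *v x\<close> is a multiple. The zero vector represents no point and needs its
  own case.\<close>

lemma plane_curve_Aut_preserves_form:
  fixes F :: "'k::field ternary_poly"
  assumes F: "homogeneous_of_degree d F" "d > 0"
    and \<sigma>: "proj_act \<sigma> ` zero_locus F = zero_locus F" and A: "A \<in> \<sigma>"
    and x: "eval_poly F x = 0"
  shows "eval_poly F (A *v x) = 0"
proof (cases "x = 0")
  case True
  then show ?thesis using eval_poly_zero_vec[OF F] by simp
next
  case False
  then have "proj_point x \<in> zero_locus F" using x by (auto simp: zero_locus_def)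
  then have "proj_act \<sigma> (proj_point x) \<in> zero_locus F" using \<sigma> by blast
  then obtain y where y: "proj_act \<sigma> (proj_point x) = proj_point y" "eval_poly F y = 0"
    by (auto simp: zero_locus_def)
  have "x = 1 *s x" by simp
  then have "x \<in> proj_point x" unfolding proj_point_def using one_neq_zero by blast
  then have "A *v x \<in> proj_act \<sigma> (proj_point x)" using A by (auto simp: proj_act_def)
  then obtain c where "A *v x = c *s y" unfolding y(1) by (auto simp: proj_point_def)
  then show ?thesis by (simp add: eval_poly_scale[OF F(1)] y(2))
qed

lemma plane_curve_Aut_pow_eq_one:
  fixes C :: "('k::{alg_closed_field, field_char_0} ^ 3) set set"
  assumes d: "d \<ge> 4" and C: "nonsingular_plane_curve d C" and \<sigma>: "\<sigma> \<in> carrier (plane_curve_Aut C)"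
  obtains N where "N \<in> {d - 1, d, d\<^sup>2 - 3 * d + 3, (d - 1)\<^sup>2, d * (d - 2), d * (d - 1)}"
    "\<sigma> [^]\<^bsub>plane_curve_Aut C\<^esub> N = \<one>\<^bsub>plane_curve_Aut C\<^esub>"
proof -
  obtain F where F: "homogeneous_of_degree d F" "nonsingular_form F" "C = zero_locus F"
    using C by (auto simp: nonsingular_plane_curve_def)
  have \<sigma>': "\<sigma> \<in> carrier PGL3" "proj_act \<sigma> ` C = C" using \<sigma> by (auto simp: plane_curve_Aut_def)
  obtain A where A: "invertible A" "\<sigma> = scalar_matrices #>\<^bsub>GL3\<^esub> A" using PGL3_carrierE[OF \<sigma>'(1)] .
  have "A \<in> \<sigma>" unfolding A(2) by (rule mem_scalar_coset)
  then have "eval_poly F (A *v x) = 0" if "eval_poly F x = 0" for x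
    using plane_curve_Aut_preserves_form[OF F(1) _ _ _ that] \<sigma>'(2) d F(3) by auto
  from preserved_nonsingular_form_imp_power_scalar[OF F(1,2) d A(1) this]
  obtain N s where N: "N \<in> {d - 1, d, d\<^sup>2 - 3 * d + 3, (d - 1)\<^sup>2, d * (d - 2), d * (d - 1)}"
    and s: "s \<noteq> 0" "\<And>x. (((*v) A) ^^ N) x = s *s x" by blast
  interpret P: group "PGL3 :: ('k ^ 3 ^ 3) set monoid" by (rule group_PGL3)
  have "\<sigma> [^]\<^bsub>PGL3\<^esub> N = \<one>\<^bsub>PGL3\<^esub>" unfolding A(2) by (rule PGL3_coset_pow_eq_one[OF A(1) s])
  then have "\<sigma> [^]\<^bsub>plane_curve_Aut C\<^esub> N = \<one>\<^bsub>plane_curve_Aut C\<^esub>"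
    unfolding plane_curve_Aut_def by (simp add: P.nat_pow_consistent[symmetric])
  with N show thesis by (rule that)
qed

theorem corollary8:
  fixes d :: nat and C :: "('k::{alg_closed_field, field_char_0} ^ 3) set set"
  assumes "d \<ge> 4"
    and "nonsingular_plane_curve d C"
  shows "(\<forall>H. subgroup H (plane_curve_Aut C)
              \<and> cyclic_group ((plane_curve_Aut C)\<lparr>carrier := H\<rparr>)
              \<and> H \<noteq> {\<one>\<^bsub>plane_curve_Aut C\<^esub>}
            \<longrightarrow> finite H \<and>
              (\<exists>n \<in> {d - 1, d, d\<^sup>2 - 3 * d + 3, (d - 1)\<^sup>2, d * (d - 2), d * (d - 1)}. card H dvd n))
       \<and> (\<forall>\<sigma> \<in> carrier (plane_curve_Aut C).
            0 < group.ord (plane_curve_Aut C) \<sigma> \<and>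
            group.ord (plane_curve_Aut C) \<sigma> \<le> d * (d - 1))"
proof -
  let ?S = "{d - 1, d, d\<^sup>2 - 3 * d + 3, (d - 1)\<^sup>2, d * (d - 2), d * (d - 1)}"
  interpret G: group "plane_curve_Aut C" by (rule group_plane_curve_Aut[OF assms(2)])
  \<comment> \<open>Positivity matters as much as the bound: a divisor of a positive number is not
    0, the value of \<open>card\<close> on infinite sets and of \<open>ord\<close> on elements of
    infinite order.\<close>
  have S: "0 < N \<and> N \<le> d * (d - 1)" if "N \<in> ?S" for N
  proof -
    obtain m where m: "d = m + 4" using assms(1) by (metis add.commute le_Suc_ex)
    have "d\<^sup>2 - 3 * d = m * m + 5 * m + 4"
      by (simp add: m power2_eq_square algebra_simps)
    then show ?thesis using that by (auto simp: m power2_eq_square algebra_simps)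
  qed
  show ?thesis
  proof (intro conjI allI impI ballI; (elim conjE)?)
    fix H
    assume H: "subgroup H (plane_curve_Aut C)" and cyc: "cyclic_group ((plane_curve_Aut C)\<lparr>carrier := H\<rparr>)"
    let ?K = "(plane_curve_Aut C)\<lparr>carrier := H\<rparr>"
    interpret K: group ?K by (rule subgroup.subgroup_is_group[OF H G.group_axioms])
    obtain x where x: "x \<in> H" "H = range (\<lambda>n::int. x [^]\<^bsub>?K\<^esub> n)"
      using cyc unfolding K.cyclic_group by auto
    then have xK: "x \<in> carrier ?K" by simp
    have card: "card H = K.ord x"
      using K.generate_pow_card[OF xK] K.generate_pow[OF xK] x(2) by (simp add: full_SetCompr_eq)
    have "x \<in> carrier (plane_curve_Aut C)" using subgroup.subset[OF H] x(1) by blast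
    then obtain N where N: "N \<in> ?S" "x [^]\<^bsub>plane_curve_Aut C\<^esub> N = \<one>\<^bsub>plane_curve_Aut C\<^esub>"
      using plane_curve_Aut_pow_eq_one[OF assms] by blast
    have "x [^]\<^bsub>?K\<^esub> N = \<one>\<^bsub>?K\<^esub>" using N(2) by (simp add: G.nat_pow_consistent[symmetric])
    then have dvd: "card H dvd N" unfolding card using K.pow_eq_id[OF xK] by blast
    with S[OF N(1)] have "card H > 0" by (auto intro: dvd_pos_nat)
    then show "finite H" by (rule card_ge_0_finite)
    show "\<exists>n\<in>?S. card H dvd n" using N(1) dvd by blast
  next
    fix \<sigma> assume \<sigma>: "\<sigma> \<in> carrier (plane_curve_Aut C)"
    then obtain N where N: "N \<in> ?S" "\<sigma> [^]\<^bsub>plane_curve_Aut C\<^esub> N = \<one>\<^bsub>plane_curve_Aut C\<^esub>"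
      using plane_curve_Aut_pow_eq_one[OF assms] by blast
    then have dvd: "G.ord \<sigma> dvd N" using G.pow_eq_id[OF \<sigma>] by blast
    show "0 < G.ord \<sigma>" using dvd S[OF N(1)] by (auto intro: dvd_pos_nat)
    have "G.ord \<sigma> \<le> N" using dvd S[OF N(1)] by (auto intro: dvd_imp_le)
    also have "N \<le> d * (d - 1)" using S[OF N(1)] by simp
    finally show "G.ord \<sigma> \<le> d * (d - 1)" .
  qed
qed

end
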